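(* Let $F_1,\dots,F_6$ be the matrix families listed in the context, and let $\mathcal F_j$ denote the set of eight orthonormal 4-qubit product vectors given by the rows of a matrix of the form $F_j$. (i) Suppose $\mathcal F$ is one of the six sets $\mathcal F_1,\mathcal F_2,\dots,\mathcal F_6$. The state $$\alpha=\frac18\Big(I-\sum_{|\psi_j\rangle\in\mathcal F}|\psi_j\rangle\langle\psi_j|\Big)$$ is at the same time a 4-qubit, a $2\times2\times4$, and a $4\times4$ PPT entangled state of rank eight. (ii) For each $j$ let $\mathcal S_{j1}$ be the set of seven product vectors obtained from $\mathcal F_j$ by deleting the vector given by the first row of $F_j$. Suppose $\mathcal S$ is one of the six sets $\mathcal S_{11}$, $\mathcal S_{21}(i_2=i_3,i_4=0)$, $\mathcal S_{31}$, $\mathcal S_{41}$, $\mathcal S_{51}$, $\mathcal S_{61}(i_2=i_3)$, where the equalities in parentheses mean that the entries of $F_2$, respectively $F_6$, are specialized accordingly. The state $$\beta=\frac19\Big(I-\sum_{|\psi_j\rangle\in\mathcal S}|\psi_j\rangle\langle\psi_j|\Big)$$ is at the same time a 4-qubit, a $2\times2\times4$, and a $4\times4$ PPT entangled state of rank nine.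
   Context: The space is $\mathcal H_A\otimes\mathcal H_B\otimes\mathcal H_C\otimes\mathcal H_D=(\mathbb C^2)^{\otimes4}$. It is regarded as a 4-qubit system $A:B:C:D$, as a $2\times2\times4$ system $\mathcal H_A\otimes\mathcal H_B\otimes\mathcal H_{CD}$, and as a $4\times4$ system $\mathcal H_{AB}\otimes\mathcal H_{CD}$. A state of a multipartite system is PPT if its partial transpose with respect to every subset of the parties is positive semidefinite, and entangled if it is not a convex combination of projectors onto product vectors of that multipartite system. Matrix notation. An $8\times4$ matrix whose entries are symbols for unit vectors of $\mathbb C^2$ (up to phase) represents the set of eight product vectors $|a\rangle\otimes|b\rangle\otimes|c\rangle\otimes|d\rangle$ given by its rows; columns $1,2,3,4$ correspond to qubits $A,B,C,D$. The symbols $0,1$ stand for the computational basis $|0\rangle,|1\rangle$; $x'$ denotes the unit vector of $\mathbb C^2$ orthogonal to $x$ (unique up to phase). Equalities and inequalities of symbols are meant up to phase. The families (always with $f_5,g_3\neq0,1$ and the further listed conditions): $$F_1=\begin{bmatrix} 0&0&0&0 \\ 0&1&0&1 \\ 1&g_3&h_3&i_3 \\ 1&g_3'&h_3&i_4 \\ f_5&g_3'&1&i_4' \\ f_5&g_3&1&i_3' \\ f_5'&0&h_3'&1 \\ f_5'&1&h_3'&0 \end{bmatrix},\quad h_3\ne0,1;\ i_3\ne0,1,i_4;\ i_4\neq0,1.$$ $$F_2=\begin{bmatrix} 0&0&0&0 \\ 0&1&0&i_2 \\ 1&g_3&h_3&i_3 \\ 1&g_3'&h_3&i_4 \\ f_5&g_3'&1&i_4'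 \\ f_5&g_3&1&i_3' \\ f_5'&1&h_3'&i_2' \\ f_5'&0&h_3'&1 \end{bmatrix},\quad h_3\ne0,1;\ i_2\neq0,1;\ i_3\neq i_4,i_4'.$$ $$F_3=\begin{bmatrix} 0&0&0&0 \\ 0&1&0&i_2 \\ 1&g_3&h_3&0 \\ 1&g_3'&h_4&i_2 \\ f_5&g_3'&1&i_2' \\ f_5&g_3&1&1 \\ f_5'&1&h_3'&i_2' \\ f_5'&0&h_4'&1 \end{bmatrix},\quad i_2\neq0,1;\ h_3\ne0,1,h_4;\ h_4\neq0,1.$$ $$F_4=\begin{bmatrix} 0&0&0&0 \\ 0&1&0&i_2 \\ 1&g_3&h_3&i_3 \\ 1&g_4&h_3&i_3' \\ f_5&g_3'&1&i_3 \\ f_5&g_4'&1&i_3' \\ f_5'&1&h_3'&i_2' \\ f_5'&0&h_3'&1 \end{bmatrix},\quad i_2\neq0,1,i_3,i_3';\ g_3\ne0,1,g_4,g_4';\ g_4\neq0,1;\ h_3\neq0,1;\ i_3\ne0,1.$$ $$F_5=\begin{bmatrix} 0&0&0&0 \\ 0&1&0&i_2 \\ 1&g_3&h_3&1 \\ 1&g_3'&h_3&i_2' \\ f_5&g_3&1&0 \\ f_6&g_3'&1&i_2 \\ f_5'&1&h_3'&i_2' \\ f_6'&0&h_3'&1 \end{bmatrix},\quad i_2\ne0,1;\ h_3\ne0,1;\ f_5\neq0,1,f_6;\ f_6\ne0,1.$$ $$F_6=\begin{bmatrix} 0&0&0&0 \\ 0&1&h_2&i_2 \\ 1&g_3&0&i_3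 \\ 1&g_3'&h_2&i_4 \\ f_5&1&h_2'&i_3' \\ f_5&0&1&i_4' \\ f_5'&g_3&1&i_2' \\ f_5'&g_3'&h_2'&1 \end{bmatrix},\quad h_2\ne0,1;\ i_2\ne0,i_3',i_4;\ i_3\neq0,i_4;\ i_4\ne0,1;\ \text{and if } i_2=i_3 \text{ then } i_2\neq 1,i_4'.$$ *)

theory Defs
  imports "HOL-Analysis.Analysis" "HOL-Library.Nonpos_Ints"
begin

(* Conjugate-linear in the first argument; the class operation of real_inner on
   complex vectors is only the real part of this. *)
definition cinner :: "complex ^ 'n \<Rightarrow> complex ^ 'n \<Rightarrow> complex" where
  "cinner u v = (\<Sum>k\<in>UNIV. cnj (u $ k) * v $ k)"

definition proj :: "complex ^ 'n \<Rightarrow> complex ^ 'n ^ 'n" where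
  "proj v = (\<chi> k l. v $ k * cnj (v $ l))"

(* Over the complex numbers, nonnegativity of the form already forces M to be Hermitian. *)
definition psd :: "complex ^ 'n ^ 'n \<Rightarrow> bool" where
  "psd M \<longleftrightarrow> (\<forall>v. cinner v (M *v v) \<in> \<real>\<^sub>\<ge>\<^sub>0)"

definition density_operator :: "complex ^ 'n ^ 'n \<Rightarrow> bool" where
  "density_operator M \<longleftrightarrow> psd M \<and> trace M = 1"

datatype qubit = qA | qB | qC | qD

instance qubit :: finite
proof
  have "(UNIV :: qubit set) = {qA, qB, qC, qD}"
    using qubit.exhaust by blast
  then show "finite (UNIV :: qubit set)"
    by (metis finite.emptyI finite.insertI)
qed

(* The computational basis of the four-fold tensor power of C^2 is indexed by the
   assignments of a basis label to each qubit. *)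
type_synonym index = "qubit \<Rightarrow> 2"
type_synonym qvec = "complex ^ 2"
type_synonym vec4 = "complex ^ index"
type_synonym op4 = "complex ^ index ^ index"

(* A multipartite system on this space is a partition of the set of qubits; each
   block is one party, whose Hilbert space is the tensor product of its qubits. *)
definition sys_4qubit :: "qubit set set" where
  "sys_4qubit = {{qA}, {qB}, {qC}, {qD}}"

definition sys_2x2x4 :: "qubit set set" where
  "sys_2x2x4 = {{qA}, {qB}, {qC, qD}}"

definition sys_4x4 :: "qubit set set" where
  "sys_4x4 = {{qA, qB}, {qC, qD}}"

(* Exchanges the labels of the qubits in S between the row and the column index. *)
definition partial_transpose :: "qubit set \<Rightarrow> op4 \<Rightarrow> op4" where
  "partial_transpose S M =
     (\<chi> x y. M $ override_on x y S $ override_on y x S)"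

definition PPT :: "qubit set set \<Rightarrow> op4 \<Rightarrow> bool" where
  "PPT P M \<longleftrightarrow> (\<forall>Q\<subseteq>P. psd (partial_transpose (\<Union>Q) M))"

(* The vector of party G is w G; its components are indexed by the labels of the
   qubits in G only. *)
definition product_vector :: "qubit set set \<Rightarrow> vec4 \<Rightarrow> bool" where
  "product_vector P v \<longleftrightarrow>
     (\<exists>w :: qubit set \<Rightarrow> index \<Rightarrow> complex. \<forall>x. v $ x = (\<Prod>G\<in>P. w G (restrict x G)))"

definition entangled :: "qubit set set \<Rightarrow> op4 \<Rightarrow> bool" where
  "entangled P M \<longleftrightarrow>
     M \<notin> convex hull {proj v |v. product_vector P v \<and> norm v = 1}"

definition PPT_entangled_state :: "qubit set set \<Rightarrow> op4 \<Rightarrow> bool" where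
  "PPT_entangled_state P M \<longleftrightarrow> density_operator M \<and> PPT P M \<and> entangled P M"

definition k0 :: qvec where "k0 = vector [1, 0]"
definition k1 :: qvec where "k1 = vector [0, 1]"

(* One representative of the orthogonal unit vector. The choice of phases is
   immaterial, since only the operators proj of the rows are used. *)
definition perp :: "qvec \<Rightarrow> qvec"  (\<open>_\<^sup>\<bottom>\<close> [1000] 999) where
  "u\<^sup>\<bottom> = vector [- cnj (u $ 2), cnj (u $ 1)]"

definition same_ray :: "qvec \<Rightarrow> qvec \<Rightarrow> bool"  (infix \<open>\<doteq>\<close> 50) where
  "u \<doteq> v \<longleftrightarrow> (\<exists>c. cmod c = 1 \<and> u = c *s v)"

definition avoids :: "qvec \<Rightarrow> qvec set \<Rightarrow> bool"  (infix \<open>avoids\<close> 50) where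
  "u avoids S \<longleftrightarrow> (\<forall>s\<in>S. \<not> u \<doteq> s)"

type_synonym row = "qvec \<times> qvec \<times> qvec \<times> qvec"

fun row_vector :: "row \<Rightarrow> vec4" where
  "row_vector (a, b, c, d) = (\<chi> x. a $ x qA * b $ x qB * c $ x qC * d $ x qD)"

definition row_vectors :: "row list \<Rightarrow> vec4 set" where
  "row_vectors M = row_vector ` set M"

definition row_vectors_but_first :: "row list \<Rightarrow> vec4 set" where
  "row_vectors_but_first M = row_vectors M - {row_vector (hd M)}"

definition F1 :: "qvec \<Rightarrow> qvec \<Rightarrow> qvec \<Rightarrow> qvec \<Rightarrow> qvec \<Rightarrow> row list" where
  "F1 f5 g3 h3 i3 i4 =
    [(k0,   k0,   k0,   k0),
     (k0,   k1,   k0,   k1),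
     (k1,   g3,   h3,   i3),
     (k1,   g3\<^sup>\<bottom>,  h3,   i4),
     (f5,   g3\<^sup>\<bottom>,  k1,   i4\<^sup>\<bottom>),
     (f5,   g3,   k1,   i3\<^sup>\<bottom>),
     (f5\<^sup>\<bottom>,  k0,   h3\<^sup>\<bottom>,  k1),
     (f5\<^sup>\<bottom>,  k1,   h3\<^sup>\<bottom>,  k0)]"

definition F1_cond :: "qvec \<Rightarrow> qvec \<Rightarrow> qvec \<Rightarrow> qvec \<Rightarrow> qvec \<Rightarrow> bool" where
  "F1_cond f5 g3 h3 i3 i4 \<longleftrightarrow>
     {f5, g3, h3, i3, i4} \<subseteq> sphere 0 1 \<and>
     f5 avoids {k0, k1} \<and> g3 avoids {k0, k1} \<and>
     h3 avoids {k0, k1} \<and> i3 avoids {k0, k1, i4} \<and> i4 avoids {k0, k1}"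

definition F2 :: "qvec \<Rightarrow> qvec \<Rightarrow> qvec \<Rightarrow> qvec \<Rightarrow> qvec \<Rightarrow> qvec \<Rightarrow> row list" where
  "F2 f5 g3 h3 i2 i3 i4 =
    [(k0,   k0,   k0,   k0),
     (k0,   k1,   k0,   i2),
     (k1,   g3,   h3,   i3),
     (k1,   g3\<^sup>\<bottom>,  h3,   i4),
     (f5,   g3\<^sup>\<bottom>,  k1,   i4\<^sup>\<bottom>),
     (f5,   g3,   k1,   i3\<^sup>\<bottom>),
     (f5\<^sup>\<bottom>,  k1,   h3\<^sup>\<bottom>,  i2\<^sup>\<bottom>),
     (f5\<^sup>\<bottom>,  k0,   h3\<^sup>\<bottom>,  k1)]"

definition F2_cond :: "qvec \<Rightarrow> qvec \<Rightarrow> qvec \<Rightarrow> qvec \<Rightarrow> qvec \<Rightarrow> qvec \<Rightarrow> bool" where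
  "F2_cond f5 g3 h3 i2 i3 i4 \<longleftrightarrow>
     {f5, g3, h3, i2, i3, i4} \<subseteq> sphere 0 1 \<and>
     f5 avoids {k0, k1} \<and> g3 avoids {k0, k1} \<and>
     h3 avoids {k0, k1} \<and> i2 avoids {k0, k1} \<and> i3 avoids {i4, i4\<^sup>\<bottom>}"

definition F3 :: "qvec \<Rightarrow> qvec \<Rightarrow> qvec \<Rightarrow> qvec \<Rightarrow> qvec \<Rightarrow> row list" where
  "F3 f5 g3 h3 h4 i2 =
    [(k0,   k0,   k0,   k0),
     (k0,   k1,   k0,   i2),
     (k1,   g3,   h3,   k0),
     (k1,   g3\<^sup>\<bottom>,  h4,   i2),
     (f5,   g3\<^sup>\<bottom>,  k1,   i2\<^sup>\<bottom>),
     (f5,   g3,   k1,   k1),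
     (f5\<^sup>\<bottom>,  k1,   h3\<^sup>\<bottom>,  i2\<^sup>\<bottom>),
     (f5\<^sup>\<bottom>,  k0,   h4\<^sup>\<bottom>,  k1)]"

definition F3_cond :: "qvec \<Rightarrow> qvec \<Rightarrow> qvec \<Rightarrow> qvec \<Rightarrow> qvec \<Rightarrow> bool" where
  "F3_cond f5 g3 h3 h4 i2 \<longleftrightarrow>
     {f5, g3, h3, h4, i2} \<subseteq> sphere 0 1 \<and>
     f5 avoids {k0, k1} \<and> g3 avoids {k0, k1} \<and>
     i2 avoids {k0, k1} \<and> h3 avoids {k0, k1, h4} \<and> h4 avoids {k0, k1}"

definition F4 :: "qvec \<Rightarrow> qvec \<Rightarrow> qvec \<Rightarrow> qvec \<Rightarrow> qvec \<Rightarrow> qvec \<Rightarrow> row list" where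
  "F4 f5 g3 g4 h3 i2 i3 =
    [(k0,   k0,   k0,   k0),
     (k0,   k1,   k0,   i2),
     (k1,   g3,   h3,   i3),
     (k1,   g4,   h3,   i3\<^sup>\<bottom>),
     (f5,   g3\<^sup>\<bottom>,  k1,   i3),
     (f5,   g4\<^sup>\<bottom>,  k1,   i3\<^sup>\<bottom>),
     (f5\<^sup>\<bottom>,  k1,   h3\<^sup>\<bottom>,  i2\<^sup>\<bottom>),
     (f5\<^sup>\<bottom>,  k0,   h3\<^sup>\<bottom>,  k1)]"

definition F4_cond :: "qvec \<Rightarrow> qvec \<Rightarrow> qvec \<Rightarrow> qvec \<Rightarrow> qvec \<Rightarrow> qvec \<Rightarrow> bool" where
  "F4_cond f5 g3 g4 h3 i2 i3 \<longleftrightarrow>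
     {f5, g3, g4, h3, i2, i3} \<subseteq> sphere 0 1 \<and>
     f5 avoids {k0, k1} \<and>
     i2 avoids {k0, k1, i3, i3\<^sup>\<bottom>} \<and> g3 avoids {k0, k1, g4, g4\<^sup>\<bottom>} \<and>
     g4 avoids {k0, k1} \<and> h3 avoids {k0, k1} \<and> i3 avoids {k0, k1}"

definition F5 :: "qvec \<Rightarrow> qvec \<Rightarrow> qvec \<Rightarrow> qvec \<Rightarrow> qvec \<Rightarrow> row list" where
  "F5 f5 f6 g3 h3 i2 =
    [(k0,   k0,   k0,   k0),
     (k0,   k1,   k0,   i2),
     (k1,   g3,   h3,   k1),
     (k1,   g3\<^sup>\<bottom>,  h3,   i2\<^sup>\<bottom>),
     (f5,   g3,   k1,   k0),
     (f6,   g3\<^sup>\<bottom>,  k1,   i2),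
     (f5\<^sup>\<bottom>,  k1,   h3\<^sup>\<bottom>,  i2\<^sup>\<bottom>),
     (f6\<^sup>\<bottom>,  k0,   h3\<^sup>\<bottom>,  k1)]"

definition F5_cond :: "qvec \<Rightarrow> qvec \<Rightarrow> qvec \<Rightarrow> qvec \<Rightarrow> qvec \<Rightarrow> bool" where
  "F5_cond f5 f6 g3 h3 i2 \<longleftrightarrow>
     {f5, f6, g3, h3, i2} \<subseteq> sphere 0 1 \<and>
     g3 avoids {k0, k1} \<and> i2 avoids {k0, k1} \<and> h3 avoids {k0, k1} \<and>
     f5 avoids {k0, k1, f6} \<and> f6 avoids {k0, k1}"

definition F6 :: "qvec \<Rightarrow> qvec \<Rightarrow> qvec \<Rightarrow> qvec \<Rightarrow> qvec \<Rightarrow> qvec \<Rightarrow> row list" where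
  "F6 f5 g3 h2 i2 i3 i4 =
    [(k0,   k0,   k0,   k0),
     (k0,   k1,   h2,   i2),
     (k1,   g3,   k0,   i3),
     (k1,   g3\<^sup>\<bottom>,  h2,   i4),
     (f5,   k1,   h2\<^sup>\<bottom>,  i3\<^sup>\<bottom>),
     (f5,   k0,   k1,   i4\<^sup>\<bottom>),
     (f5\<^sup>\<bottom>,  g3,   k1,   i2\<^sup>\<bottom>),
     (f5\<^sup>\<bottom>,  g3\<^sup>\<bottom>,  h2\<^sup>\<bottom>,  k1)]"

definition F6_cond :: "qvec \<Rightarrow> qvec \<Rightarrow> qvec \<Rightarrow> qvec \<Rightarrow> qvec \<Rightarrow> qvec \<Rightarrow> bool" where
  "F6_cond f5 g3 h2 i2 i3 i4 \<longleftrightarrow>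
     {f5, g3, h2, i2, i3, i4} \<subseteq> sphere 0 1 \<and>
     f5 avoids {k0, k1} \<and> g3 avoids {k0, k1} \<and>
     h2 avoids {k0, k1} \<and> i2 avoids {k0, i3\<^sup>\<bottom>, i4} \<and>
     i3 avoids {k0, i4} \<and> i4 avoids {k0, k1} \<and>
     (i2 \<doteq> i3 \<longrightarrow> i2 avoids {k1, i4\<^sup>\<bottom>})"

definition family1 :: "row list set" where
  "family1 = {F1 f5 g3 h3 i3 i4 |f5 g3 h3 i3 i4. F1_cond f5 g3 h3 i3 i4}"

definition family2 :: "row list set" where
  "family2 = {F2 f5 g3 h3 i2 i3 i4 |f5 g3 h3 i2 i3 i4. F2_cond f5 g3 h3 i2 i3 i4}"

definition family3 :: "row list set" where
  "family3 = {F3 f5 g3 h3 h4 i2 |f5 g3 h3 h4 i2. F3_cond f5 g3 h3 h4 i2}"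

definition family4 :: "row list set" where
  "family4 = {F4 f5 g3 g4 h3 i2 i3 |f5 g3 g4 h3 i2 i3. F4_cond f5 g3 g4 h3 i2 i3}"

definition family5 :: "row list set" where
  "family5 = {F5 f5 f6 g3 h3 i2 |f5 f6 g3 h3 i2. F5_cond f5 f6 g3 h3 i2}"

definition family6 :: "row list set" where
  "family6 = {F6 f5 g3 h2 i2 i3 i4 |f5 g3 h2 i2 i3 i4. F6_cond f5 g3 h2 i2 i3 i4}"

definition family2_special :: "row list set" where
  "family2_special = {F2 f5 g3 h3 i2 i3 i4 |f5 g3 h3 i2 i3 i4.
     F2_cond f5 g3 h3 i2 i3 i4 \<and> i2 \<doteq> i3 \<and> i4 \<doteq> k0}"

definition family6_special :: "row list set" where
  "family6_special = {F6 f5 g3 h2 i2 i3 i4 |f5 g3 h2 i2 i3 i4.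
     F6_cond f5 g3 h2 i2 i3 i4 \<and> i2 \<doteq> i3}"

end

theory Submission
  imports Defs
begin

text \<open>
  Complex conjugation of some tensor factors keeps product vectors orthonormal, so all partial
  transposes of the given operators are multiples of projectors. If such an operator were
  separable, its range would be spanned by product vectors orthogonal to the given rows. For the
  coarsest system such a vector is \<open>X \<otimes> Y\<close> with \<open>X\<close> on \<open>AB\<close> and \<open>Y\<close> on \<open>CD\<close>, and every row
  is orthogonal to \<open>X\<close> or to \<open>Y\<close> in the respective factor. A nonzero bilinear form on two
  qubits vanishes on few product vectors, which leaves only few partitions of the rows. Each of them determines \<open>X \<otimes> Y\<close> up to
  a scalar, and there are always fewer of them than the rank.

  The partitions are counted by evaluating a test on symbolic tables. It uses three facts about the
  zero set of a nonzero form: two zeros in one line \<open>{p} \<times> P\<^sup>1\<close> put the whole line into the zero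
  set, two different parallel lines cannot both lie in it, and certain configurations of two
  antipodal pairs are excluded. Cross-ratio coincidences that cannot be excluded are simply
  counted.
\<close>

section \<open>Bilinear forms on pairs of qubit states\<close>

type_synonym point = "complex option"

text \<open>\<^term>\<open>None\<close> is the point at infinity, the ray of \<^term>\<open>k1\<close>.\<close>

definition hom :: "point \<Rightarrow> 2 \<Rightarrow> complex" where
  "hom p i = (case p of None \<Rightarrow> if i = 1 then 0 else 1 | Some z \<Rightarrow> if i = 1 then 1 else z)"

text \<open>The antipodal map of the Riemann sphere, that is, passage to the orthogonal ray.\<close>

definition antipode :: "point \<Rightarrow> point" where
  "antipode p = (case p of None \<Rightarrow> Some 0 | Some z \<Rightarrow> if z = 0 then None else Some (- 1 / cnj z))"

definition form :: "(2 \<Rightarrow> 2 \<Rightarrow> complex) \<Rightarrow> point \<Rightarrow> point \<Rightarrow> complex" where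
  "form X p q = (\<Sum>i\<in>UNIV. \<Sum>j\<in>UNIV. X i j * hom p i * hom q j)"

lemma hom_simps [simp]:
  "hom None 1 = 0" "hom None 2 = 1" "hom (Some z) 1 = 1" "hom (Some z) 2 = z"
  by (simp_all add: hom_def)

lemma hom_det: "hom p 1 * hom q 2 = hom p 2 * hom q 1 \<longleftrightarrow> p = q"
  by (cases p; cases q) auto

lemma hom_nonzero: "hom p 1 \<noteq> 0 \<or> hom p 2 \<noteq> 0"
  by (cases p) auto

lemma hom_antipode:
  obtains c where "c \<noteq> 0" "hom (antipode p) 1 = - c * cnj (hom p 2)"
    "hom (antipode p) 2 = c * cnj (hom p 1)"
proof (cases p)
  case None
  then show ?thesis using that[of "-1"] by (simp add: antipode_def)
next
  case (Some z)
  show ?thesis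
  proof (cases "z = 0")
    case True
    then show ?thesis using that[of 1] Some by (simp add: antipode_def)
  next
    case False
    then show ?thesis using that[of "- 1 / cnj z"] Some by (simp add: antipode_def)
  qed
qed

lemma antipode_antipode [simp]: "antipode (antipode p) = p"
  by (cases p) (auto simp: antipode_def)

lemma antipode_neq [simp]: "antipode p \<noteq> p"
proof (cases p)
  case (Some z)
  \<comment> \<open>A fixed point would satisfy \<open>z * cnj z = - 1\<close>, but this product is
    a nonnegative real.\<close>
  have "- 1 \<noteq> z * cnj z"
  proof
    assume "- 1 = z * cnj z"
    then have "Re (- 1) = Re (z * cnj z)" by simp
    then have "- 1 = (Re z)\<^sup>2 + (Im z)\<^sup>2" by (simp add: power2_eq_square)
    then show False by (smt (verit) zero_le_power2)
  qed
  then have "z \<noteq> 0 \<Longrightarrow> - 1 / cnj z \<noteq> z" by (simp add: field_simps)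
  then show ?thesis using Some by (auto simp: antipode_def)
qed (simp add: antipode_def)

section \<open>Zero sets of bilinear forms on two projective lines\<close>

lemma form_expand:
  "form X p q = X 1 1 * hom p 1 * hom q 1 + X 1 2 * hom p 1 * hom q 2 +
     X 2 1 * hom p 2 * hom q 1 + X 2 2 * hom p 2 * hom q 2"
  by (simp add: form_def sum_2)

lemma form_swap: "form (\<lambda>i j. X j i) p q = form X q p"
  by (simp add: form_expand)

lemma solve_two:
  fixes a :: complex
  assumes "a * s + b * t = 0" "c * s + d * t = 0" "a * d \<noteq> b * c"
  shows "s = 0 \<and> t = 0"
proof -
  have "(a * d - b * c) * s = d * (a * s + b * t) - b * (c * s + d * t)"
       "(a * d - b * c) * t = a * (c * s + d * t) - c * (a * s + b * t)"
    by (simp_all add: algebra_simps)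
  then have "(a * d - b * c) * s = 0" "(a * d - b * c) * t = 0"
    unfolding assms(1,2) by simp_all
  then show ?thesis using assms(3) by simp
qed

text \<open>With \<open>p\<close> fixed the form is a linear functional of the second argument, and
  two independent zeros annihilate it.\<close>

lemma form_row:
  assumes "form X p q = 0" "form X p q' = 0" "q \<noteq> q'"
  shows "form X p r = 0"
proof -
  let ?s = "X 1 1 * hom p 1 + X 2 1 * hom p 2" and ?t = "X 1 2 * hom p 1 + X 2 2 * hom p 2"
  have e: "form X p r = hom r 1 * ?s + hom r 2 * ?t" for r
    by (simp add: form_expand algebra_simps)
  have "?s = 0 \<and> ?t = 0"
    using assms solve_two[of "hom q 1" ?s "hom q 2" ?t "hom q' 1" "hom q' 2"]
    by (simp add: e hom_det)
  then show ?thesis by (simp add: e)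
qed

lemma form_col:
  assumes "form X p q = 0" "form X p' q = 0" "p \<noteq> p'"
  shows "form X r q = 0"
  using form_row[of "\<lambda>i j. X j i" q p p' r] assms by (simp add: form_swap[of X])

text \<open>Every column meets the two full lines in two zeros, hence is full itself; the coordinate
  points then read off the entries of \<open>X\<close>.\<close>

lemma form_zero:
  assumes "\<And>r. form X p r = 0" "\<And>r. form X p' r = 0" "p \<noteq> p'"
  shows "X = (\<lambda>_ _. 0)"
proof -
  have z: "form X u v = 0" for u v
    by (rule form_col[OF assms(1,2,3)])
  have "X 1 1 = 0" "X 1 2 = 0" "X 2 1 = 0" "X 2 2 = 0"
    using z[of "Some 0" "Some 0"] z[of "Some 0" None] z[of None "Some 0"] z[of None None]
    by (simp_all add: form_expand)
  then have "X i j = 0" for i j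
    using exhaust_2[of i] exhaust_2[of j] by auto
  then show ?thesis by blast
qed

text \<open>The line over \<open>p\<close> is full and supplies one zero in each of the columns
  \<open>b\<close> and \<open>b'\<close>. The zeros at \<open>a\<close> and \<open>a'\<close> supply
  a second one, so two parallel lines are full.\<close>

lemma form_blocked:
  assumes "form X p q = 0" "form X p q' = 0" "q \<noteq> q'"
    and "form X a b = 0" "a \<noteq> p" "form X a' b' = 0" "a' \<noteq> p" "b \<noteq> b'"
  shows "X = (\<lambda>_ _. 0)"
proof -
  note row = form_row[OF assms(1-3)]
  have col: "form X r b = 0" "form X r b' = 0" for r
    using form_col[OF row assms(4) assms(5)[symmetric]]
      form_col[OF row assms(6) assms(7)[symmetric]] by blast+
  have "(\<lambda>i j. X j i) = (\<lambda>_ _. 0)"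
    by (rule form_zero[of "\<lambda>i j. X j i" b b']) (simp_all add: form_swap[of X] col assms(8))
  then show ?thesis by (simp add: fun_eq_iff)
qed

lemma form_linear_combination:
  "form (\<lambda>i j. c * X i j - d * Y i j) p q = c * form X p q - d * form Y p q"
  by (simp add: form_expand algebra_simps)

text \<open>On the linear space of forms vanishing on \<open>S\<close>, evaluation at
  \<open>(a, b)\<close> is injective, so this space has dimension at most one.\<close>

lemma proportional_if_test_point:
  assumes "\<And>Z. (\<And>p q. (p, q) \<in> S \<Longrightarrow> form Z p q = 0) \<Longrightarrow> form Z a b = 0 \<Longrightarrow> Z = (\<lambda>_ _. 0)"
    and X: "\<And>p q. (p, q) \<in> S \<Longrightarrow> form X p q = 0" "X \<noteq> (\<lambda>_ _. 0)"
    and Y: "\<And>p q. (p, q) \<in> S \<Longrightarrow> form Y p q = 0"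
  shows "\<exists>c. Y = (\<lambda>i j. c * X i j)"
proof -
  have n: "form X a b \<noteq> 0"
    using assms(1)[of X] X by blast
  have "(\<lambda>i j. form X a b * Y i j - form Y a b * X i j) = (\<lambda>_ _. 0)"
    by (rule assms(1)) (simp_all add: form_linear_combination X Y)
  then have "form X a b * Y i j = form Y a b * X i j" for i j
    by (simp add: fun_eq_iff)
  then have "Y i j = (form Y a b / form X a b) * X i j" for i j
    using n by (metis nonzero_mult_div_cancel_left times_divide_eq_left)
  then show ?thesis by blast
qed

lemma form_unique_row:
  assumes X: "form X p q = 0" "form X p q' = 0" "form X a b = 0" "X \<noteq> (\<lambda>_ _. 0)"
    and Y: "form Y p q = 0" "form Y p q' = 0" "form Y a b = 0"
    and ne: "q \<noteq> q'" "a \<noteq> p"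
  shows "\<exists>c. Y = (\<lambda>i j. c * X i j)"
proof (rule proportional_if_test_point)
  fix Z :: "2 \<Rightarrow> 2 \<Rightarrow> complex"
  assume Z: "\<And>r s. (r, s) \<in> {(p, q), (p, q'), (a, b)} \<Longrightarrow> form Z r s = 0"
    and t: "form Z a (antipode b) = 0"
  \<comment> \<open>The antipode serves as a point different from \<open>b\<close>: row
    \<open>a\<close> gets a second zero, and two columns become full.\<close>
  show "Z = (\<lambda>_ _. 0)"
    by (rule form_blocked[of Z p q q' a b a "antipode b"])
      (use Z t ne antipode_neq[of b, symmetric] in auto)
qed (use assms in auto)

lemma form_unique_distinct:
  assumes X: "form X p q = 0" "form X p' q' = 0" "form X p'' q'' = 0" "X \<noteq> (\<lambda>_ _. 0)"
    and Y: "form Y p q = 0" "form Y p' q' = 0" "form Y p'' q'' = 0"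
    and ne: "p \<noteq> p'" "p \<noteq> p''" "q \<noteq> q'" "q' \<noteq> q''"
  shows "\<exists>c. Y = (\<lambda>i j. c * X i j)"
proof (rule proportional_if_test_point)
  fix Z :: "2 \<Rightarrow> 2 \<Rightarrow> complex"
  assume Z: "\<And>r s. (r, s) \<in> {(p, q), (p', q'), (p'', q'')} \<Longrightarrow> form Z r s = 0"
    and t: "form Z p q' = 0"
  \<comment> \<open>The test point \<open>(p, q')\<close> fills the line over \<open>p\<close>; the
    other two zeros then fill the columns \<open>q'\<close> and \<open>q''\<close>.\<close>
  show "Z = (\<lambda>_ _. 0)"
    by (rule form_blocked[of Z p q q' p' q' p'' q'']) (use Z t ne in auto)
qed (use assms in auto)

text \<open>A covector annihilating a ray is a multiple of its image under the unitary map (x, y) to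
  (-y, x), which preserves orthogonality.\<close>

lemma form_antipode_orthogonal:
  fixes s t s' t' :: complex
  assumes "s * hom p 1 + t * hom p 2 = 0"
    and "s' * hom (antipode p) 1 + t' * hom (antipode p) 2 = 0"
  shows "s * cnj s' + t * cnj t' = 0"
proof -
  obtain c where c: "c \<noteq> 0" "hom (antipode p) 1 = - c * cnj (hom p 2)"
    "hom (antipode p) 2 = c * cnj (hom p 1)"
    by (rule hom_antipode)
  have "c * (t' * cnj (hom p 1) - s' * cnj (hom p 2)) = 0"
    using assms(2) unfolding c by (simp add: algebra_simps)
  then have "t' * cnj (hom p 1) = s' * cnj (hom p 2)" using c by simp
  then have "cnj (t' * cnj (hom p 1)) = cnj (s' * cnj (hom p 2))" by simp
  then have e: "cnj t' * hom p 1 = cnj s' * hom p 2" by simp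
  have "(s * cnj s' + t * cnj t') * hom p 1 =
      (s * hom p 1 + t * hom p 2) * cnj s' + t * (cnj t' * hom p 1 - cnj s' * hom p 2)"
    "(s * cnj s' + t * cnj t') * hom p 2 =
      (s * hom p 1 + t * hom p 2) * cnj t' - s * (cnj t' * hom p 1 - cnj s' * hom p 2)"
    by (simp_all add: algebra_simps)
  then show ?thesis using assms(1) e hom_nonzero[of p] by auto
qed

text \<open>The map sending \<open>w\<close> to the covector \<open>form X w\<close> turns the four equations into two
  orthogonality relations. Their difference is \<open>trace (X\<^sup>* X)\<close> times the determinant of
  \<open>u\<close> and \<open>v\<close>.\<close>

lemma form_blocked_antipodal:
  assumes up: "form X u p = 0" and vp: "form X (antipode v) (antipode p) = 0"
    and vr: "form X v r = 0" and ur: "form X (antipode u) (antipode r) = 0"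
    and ne: "u \<noteq> v"
  shows "X = (\<lambda>_ _. 0)"
proof -
  define m where "m w j = X 1 j * hom w 1 + X 2 j * hom w 2" for w j
  have f: "form X w q = m w 1 * hom q 1 + m w 2 * hom q 2" for w q
    by (simp add: form_expand m_def algebra_simps)
  obtain c where c: "c \<noteq> 0" "hom (antipode v) 1 = - c * cnj (hom v 2)"
    "hom (antipode v) 2 = c * cnj (hom v 1)"
    by (rule hom_antipode)
  obtain d where d: "d \<noteq> 0" "hom (antipode u) 1 = - d * cnj (hom u 2)"
    "hom (antipode u) 2 = d * cnj (hom u 1)"
    by (rule hom_antipode)
  have e1: "m u 1 * cnj (m (antipode v) 1) + m u 2 * cnj (m (antipode v) 2) = 0"
    using form_antipode_orthogonal[of "m u 1" p "m u 2"] up vp by (simp add: f)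
  have e2: "m v 1 * cnj (m (antipode u) 1) + m v 2 * cnj (m (antipode u) 2) = 0"
    using form_antipode_orthogonal[of "m v 1" r "m v 2"] vr ur by (simp add: f)
  \<comment> \<open>The entries of the Gram matrix of the two rows of \<open>X\<close>.\<close>
  define \<alpha> where "\<alpha> = X 1 1 * cnj (X 1 1) + X 1 2 * cnj (X 1 2)"
  define \<delta> where "\<delta> = X 2 1 * cnj (X 2 1) + X 2 2 * cnj (X 2 2)"
  define \<beta> where "\<beta> = X 1 1 * cnj (X 2 1) + X 1 2 * cnj (X 2 2)"
  define \<beta>' where "\<beta>' = X 2 1 * cnj (X 1 1) + X 2 2 * cnj (X 1 2)"
  have "cnj c * (- hom u 1 * hom v 2 * \<alpha> + hom u 1 * hom v 1 * \<beta>
      - hom u 2 * hom v 2 * \<beta>' + hom u 2 * hom v 1 * \<delta>) = 0"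
    using e1 unfolding m_def c \<alpha>_def \<beta>_def \<beta>'_def \<delta>_def by (simp add: algebra_simps)
  moreover have "cnj d * (- hom v 1 * hom u 2 * \<alpha> + hom v 1 * hom u 1 * \<beta>
      - hom v 2 * hom u 2 * \<beta>' + hom v 2 * hom u 1 * \<delta>) = 0"
    using e2 unfolding m_def d \<alpha>_def \<beta>_def \<beta>'_def \<delta>_def by (simp add: algebra_simps)
  ultimately have "- hom u 1 * hom v 2 * \<alpha> + hom u 1 * hom v 1 * \<beta>
      - hom u 2 * hom v 2 * \<beta>' + hom u 2 * hom v 1 * \<delta> =
      - hom v 1 * hom u 2 * \<alpha> + hom v 1 * hom u 1 * \<beta>
      - hom v 2 * hom u 2 * \<beta>' + hom v 2 * hom u 1 * \<delta>"
    using c d by simp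
  \<comment> \<open>The terms with \<open>\<beta>\<close> and \<open>\<beta>'\<close> are symmetric
    in \<open>u\<close> and \<open>v\<close> and cancel.\<close>
  then have "(\<alpha> + \<delta>) * (hom u 1 * hom v 2 - hom u 2 * hom v 1) = 0"
    by (simp add: algebra_simps)
  then have "\<alpha> + \<delta> = 0"
    using ne hom_det[of u v] by simp
  then have "Re (\<alpha> + \<delta>) = 0" by simp
  then have "(cmod (X 1 1))\<^sup>2 + (cmod (X 1 2))\<^sup>2 + (cmod (X 2 1))\<^sup>2 + (cmod (X 2 2))\<^sup>2 = 0"
    unfolding \<alpha>_def \<delta>_def by (simp add: cmod_power2) (simp add: power2_eq_square)
  then have "X 1 1 = 0 \<and> X 1 2 = 0 \<and> X 2 1 = 0 \<and> X 2 2 = 0"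
    by (smt (verit) zero_le_power2 zero_eq_power2 norm_eq_zero)
  then have "X i j = 0" for i j
    using exhaust_2[of i] exhaust_2[of j] by auto
  then show ?thesis by blast
qed

text \<open>The conjugation makes \<^term>\<open>form\<close>, which is bilinear, compute the inner product of a
  product vector with \<open>X\<close>, see \<open>form_point_of\<close> below.\<close>

definition point_of :: "qvec \<Rightarrow> point" where
  "point_of u = (if u $ 1 = 0 then None else Some (cnj (u $ 2 / u $ 1)))"

lemma hom_point_of:
  assumes "u \<noteq> 0"
  obtains c where "c \<noteq> 0" "\<And>i. cnj (u $ i) = c * hom (point_of u) i"
proof (cases "u $ 1 = 0")
  case True
  then have "cnj (u $ 2) \<noteq> 0" using assms by (auto simp: vec_eq_iff forall_2)
  moreover have "cnj (u $ i) = cnj (u $ 2) * hom (point_of u) i" for i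
    using True exhaust_2[of i] by (auto simp: point_of_def)
  ultimately show ?thesis by (rule that)
next
  case False
  then have "cnj (u $ 1) \<noteq> 0" by simp
  moreover have "cnj (u $ i) = cnj (u $ 1) * hom (point_of u) i" for i
    using False exhaust_2[of i] by (auto simp: point_of_def)
  ultimately show ?thesis by (rule that)
qed

lemma norm_qvec: "(norm (u :: qvec))\<^sup>2 = (cmod (u $ 1))\<^sup>2 + (cmod (u $ 2))\<^sup>2"
  by (simp add: norm_vec_def L2_set_def sum_2)

lemma point_of_perp: "u \<noteq> 0 \<Longrightarrow> point_of (perp u) = antipode (point_of u)"
  by (auto simp: point_of_def perp_def antipode_def vec_eq_iff forall_2)

text \<open>Equal points make the vectors proportional, and unit norms force the factor to have
  modulus one.\<close>

lemma same_ray_if_point_of_eq: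
  assumes "norm u = 1" "norm v = 1" "point_of u = point_of v"
  shows "u \<doteq> v"
proof -
  have nz: "u \<noteq> 0" "v \<noteq> 0" using assms by auto
  obtain c where c: "c \<noteq> 0" "\<And>i. cnj (u $ i) = c * hom (point_of u) i"
    using hom_point_of[OF nz(1)] by metis
  obtain d where d: "d \<noteq> 0" "\<And>i. cnj (v $ i) = d * hom (point_of v) i"
    using hom_point_of[OF nz(2)] by metis
  have "cnj (u $ i) = c / d * cnj (v $ i)" for i
    using c d assms(3) by simp
  then have "u $ i = cnj (c / d) * v $ i" for i
    by (metis complex_cnj_cnj complex_cnj_mult)
  then have e: "u = cnj (c / d) *s v"
    by (simp add: vec_eq_iff)
  have "(norm u)\<^sup>2 = (cmod (c / d))\<^sup>2 * (norm v)\<^sup>2"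
    unfolding norm_qvec by (subst (1 2) e) (simp add: norm_mult norm_divide power_mult_distrib power_divide algebra_simps)
  then have "cmod (cnj (c / d)) = 1" using assms norm_ge_zero[of "c / d"]
    unfolding complex_mod_cnj by (simp add: power2_eq_1_iff del: norm_ge_zero)
  then show ?thesis using e unfolding same_ray_def by blast
qed

lemma point_of_eq_if_same_ray: "u \<doteq> v \<Longrightarrow> point_of u = point_of v"
  by (auto simp: same_ray_def point_of_def)

section \<open>Partitions of symbolic tables\<close>

text \<open>The general vector factoring across the cut AB|CD. Both \<open>X\<close> and
  \<open>Y\<close> also act as bilinear forms on pairs of qubit states.\<close>

definition tensor :: "(2 \<Rightarrow> 2 \<Rightarrow> complex) \<Rightarrow> (2 \<Rightarrow> 2 \<Rightarrow> complex) \<Rightarrow> vec4" where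
  "tensor X Y = (\<chi> x. X (x qA) (x qB) * Y (x qC) (x qD))"

text \<open>A symbol stands for an unspecified qubit state, \<open>Q' n\<close> for the state orthogonal to \<open>Q n\<close>.
  Each column of a matrix has its own symbols, and \<open>Q 0\<close> is always \<^term>\<open>k0\<close>. Different symbols may
  denote the same ray unless a list of pairs, closed under \<open>dual\<close> by \<open>apart\<close>, says otherwise.\<close>

datatype symbol = Q nat | Q' nat

fun dual :: "symbol \<Rightarrow> symbol" where
  "dual (Q n) = Q' n"
| "dual (Q' n) = Q n"

lemma dual_dual [simp]: "dual (dual p) = p"
  by (cases p) auto

type_synonym side = "(symbol \<times> symbol) list"
type_synonym table = "(symbol \<times> symbol \<times> symbol \<times> symbol) list"

definition models :: "(symbol \<Rightarrow> point) \<Rightarrow> (symbol \<times> symbol) list \<Rightarrow> bool" where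
  "models I E \<longleftrightarrow> (\<forall>p. I (dual p) = antipode (I p)) \<and> (\<forall>(p, q)\<in>set E. I p \<noteq> I q)"

definition apart :: "(symbol \<times> symbol) list \<Rightarrow> symbol \<Rightarrow> symbol \<Rightarrow> bool" where
  "apart E p q \<longleftrightarrow> p = dual q \<or> (p, q) \<in> set E \<or> (q, p) \<in> set E \<or>
     (dual p, dual q) \<in> set E \<or> (dual q, dual p) \<in> set E"

lemma models_dual: "models I E \<Longrightarrow> I (dual p) = antipode (I p)"
  by (simp add: models_def)

text \<open>The antipodal map has no fixed point and, being an involution, is injective; thus dual
  symbols differ and a listed inequality passes to the duals.\<close>

lemma models_apart:
  assumes "models I E" "apart E p q"
  shows "I p \<noteq> I q"
proof -
  have "(r, s) \<in> set E \<Longrightarrow> I r \<noteq> I s" for r s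
    using assms(1) by (auto simp: models_def)
  moreover have "I (dual r) = antipode (I r)" for r
    using assms(1) by (rule models_dual)
  ultimately show ?thesis
    using assms(2) unfolding apart_def by (metis antipode_neq)
qed

section \<open>Syntactic tests for zero sets\<close>

definition kills ::
  "(2 \<Rightarrow> 2 \<Rightarrow> complex) \<Rightarrow> (symbol \<Rightarrow> point) \<Rightarrow> (symbol \<Rightarrow> point) \<Rightarrow> side \<Rightarrow> bool" where
  "kills X I J ps \<longleftrightarrow> (\<forall>(p, q)\<in>set ps. form X (I p) (J q) = 0)"

definition swap_all :: "side \<Rightarrow> side" where
  "swap_all = map prod.swap"

lemma kills_swap_all: "kills (\<lambda>i j. X j i) J I (swap_all ps) \<longleftrightarrow> kills X I J ps"
  by (auto simp: kills_def swap_all_def form_swap[of X])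

lemma killsD: "kills X I J ps \<Longrightarrow> (p, q) \<in> set ps \<Longrightarrow> form X (I p) (J q) = 0"
  by (auto simp: kills_def)

lemma transpose_nonzero: "X \<noteq> (\<lambda>_ _. 0) \<Longrightarrow> (\<lambda>i j. X j i :: complex) \<noteq> (\<lambda>_ _. 0)"
  by (auto simp: fun_eq_iff)

type_synonym apartness = "symbol \<Rightarrow> symbol \<Rightarrow> bool"

text \<open>The hypotheses of \<open>form_blocked\<close>, with \<open>d\<close> and
  \<open>e\<close> as the known inequalities in the first and second column.\<close>

definition row_blocked :: "apartness \<Rightarrow> apartness \<Rightarrow> side \<Rightarrow> bool" where
  "row_blocked d e ps \<longleftrightarrow>
     (\<exists>(p, q)\<in>set ps. \<exists>(p', q')\<in>set ps. p = p' \<and> e q q' \<and>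
        (\<exists>(a, b)\<in>set ps. d a p \<and> (\<exists>(a', b')\<in>set ps. d a' p \<and> e b b')))"

definition antipodal_blocked :: "apartness \<Rightarrow> side \<Rightarrow> bool" where
  "antipodal_blocked d ps \<longleftrightarrow>
     (\<exists>(u, p)\<in>set ps. \<exists>(v, r)\<in>set ps. d u v \<and>
        (dual u, dual r) \<in> set ps \<and> (dual v, dual p) \<in> set ps)"

text \<open>A sufficient test that only the zero form kills \<open>ps\<close>. Swapping covers the
  transposed configuration.\<close>

definition blocked :: "apartness \<Rightarrow> apartness \<Rightarrow> side \<Rightarrow> bool" where
  "blocked d e ps \<longleftrightarrow> row_blocked d e ps \<or> row_blocked e d (swap_all ps) \<or> antipodal_blocked d ps"

text \<open>A leak shows that a form killing \<open>ps\<close> must kill some element of \<open>qs\<close> as well. Discarding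
  splits with a leak counts each product vector only once, for the exact zero set of its first
  factor.\<close>

definition row_leak :: "apartness \<Rightarrow> apartness \<Rightarrow> side \<Rightarrow> side \<Rightarrow> bool" where
  "row_leak d e ps qs \<longleftrightarrow>
     (\<exists>(p, q)\<in>set ps. \<exists>(p', q')\<in>set ps. p = p' \<and> e q q' \<and>
       (p \<in> fst ` set qs \<or> (\<exists>(a, b)\<in>set ps. d a p \<and> b \<in> snd ` set qs)))"

definition leak :: "apartness \<Rightarrow> apartness \<Rightarrow> side \<Rightarrow> side \<Rightarrow> bool" where
  "leak d e ps qs \<longleftrightarrow> row_leak d e ps qs \<or> row_leak e d (swap_all ps) (swap_all qs)"

definition row_rigid :: "apartness \<Rightarrow> apartness \<Rightarrow> side \<Rightarrow> bool" where
  "row_rigid d e ps \<longleftrightarrow>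
     (\<exists>(p, q)\<in>set ps. \<exists>(p', q')\<in>set ps. p = p' \<and> e q q' \<and> (\<exists>(a, b)\<in>set ps. d a p))"

text \<open>Hypotheses of \<open>form_unique_row\<close>, its transpose, and
  \<open>form_unique_distinct\<close>: the forms killing \<open>ps\<close> are then at most
  one-dimensional.\<close>

definition rigid :: "apartness \<Rightarrow> apartness \<Rightarrow> side \<Rightarrow> bool" where
  "rigid d e ps \<longleftrightarrow> row_rigid d e ps \<or> row_rigid e d (swap_all ps) \<or>
     (\<exists>(p, q)\<in>set ps. \<exists>(p', q')\<in>set ps. d p p' \<and> e q q' \<and>
        (\<exists>(a, b)\<in>set ps. d p a \<and> e q' b))"

section \<open>Soundness of the tests\<close>

lemma not_row_blocked:
  assumes "kills X I J ps" "X \<noteq> (\<lambda>_ _. 0)"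
    and d: "\<And>p q. d p q \<Longrightarrow> I p \<noteq> I q" and e: "\<And>p q. e p q \<Longrightarrow> J p \<noteq> J q"
  shows "\<not> row_blocked d e ps"
proof
  assume "row_blocked d e ps"
  then obtain p q q' a b a' b' where
    "(p, q) \<in> set ps" "(p, q') \<in> set ps" "e q q'" "(a, b) \<in> set ps" "d a p"
    "(a', b') \<in> set ps" "d a' p" "e b b'"
    unfolding row_blocked_def by blast
  then show False
    using form_blocked[of X "I p" "J q" "J q'" "I a" "J b" "I a'" "J b'"] d e assms(2)
      killsD[OF assms(1)] by blast
qed

lemma not_antipodal_blocked:
  assumes "kills X I J ps" "X \<noteq> (\<lambda>_ _. 0)"
    and d: "\<And>p q. d p q \<Longrightarrow> I p \<noteq> I q"
    and dual: "\<And>p. I (dual p) = antipode (I p)" "\<And>p. J (dual p) = antipode (J p)"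
  shows "\<not> antipodal_blocked d ps"
proof
  assume "antipodal_blocked d ps"
  then obtain u p v r where
    "(u, p) \<in> set ps" "(v, r) \<in> set ps" "d u v"
    "(dual u, dual r) \<in> set ps" "(dual v, dual p) \<in> set ps"
    unfolding antipodal_blocked_def by blast
  then show False
    using form_blocked_antipodal[of X "I u" "J p" "I v" "J r"] d assms(2)
      killsD[OF assms(1)] dual by metis
qed

lemma not_blocked:
  assumes "kills X I J ps" "X \<noteq> (\<lambda>_ _. 0)" "models I D" "models J E"
  shows "\<not> blocked (apart D) (apart E) ps"
  unfolding blocked_def
  using not_row_blocked[OF assms(1,2)] not_antipodal_blocked[OF assms(1,2)]
    not_row_blocked[OF iffD2[OF kills_swap_all assms(1)] transpose_nonzero[OF assms(2)]]
    models_apart[OF assms(3)] models_apart[OF assms(4)]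
    models_dual[OF assms(3)] models_dual[OF assms(4)]
  by blast

text \<open>The line over \<open>p\<close> is full and contains any pair with first entry
  \<open>p\<close>. A zero \<open>(a, b)\<close> off this line fills column \<open>b\<close>, and so
  reaches any pair with second entry \<open>b\<close>.\<close>

lemma not_row_leak:
  assumes "kills X I J ps" "\<And>p q. (p, q) \<in> set qs \<Longrightarrow> form X (I p) (J q) \<noteq> 0"
    and d: "\<And>p q. d p q \<Longrightarrow> I p \<noteq> I q" and e: "\<And>p q. e p q \<Longrightarrow> J p \<noteq> J q"
  shows "\<not> row_leak d e ps qs"
proof
  assume "row_leak d e ps qs"
  then obtain p q q' where p: "(p, q) \<in> set ps" "(p, q') \<in> set ps" "e q q'"
    and disj: "p \<in> fst ` set qs \<or> (\<exists>(a, b)\<in>set ps. d a p \<and> b \<in> snd ` set qs)"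
    unfolding row_leak_def by blast
  have row: "form X (I p) r = 0" for r
    using form_row[of X "I p" "J q" "J q'"] p e killsD[OF assms(1)] by blast
  from disj show False
  proof
    assume "p \<in> fst ` set qs"
    then show False using assms(2) row by force
  next
    assume "\<exists>(a, b)\<in>set ps. d a p \<and> b \<in> snd ` set qs"
    then obtain a b c where "(a, b) \<in> set ps" "d a p" "(c, b) \<in> set qs" by force
    then show False
      using form_col[OF row[of "J b"], of "I a" "I c"] assms(2) killsD[OF assms(1)] d by metis
  qed
qed

lemma not_leak:
  assumes "kills X I J ps" "\<And>p q. (p, q) \<in> set qs \<Longrightarrow> form X (I p) (J q) \<noteq> 0"
    and "models I D" "models J E"
  shows "\<not> leak (apart D) (apart E) ps qs"
proof -
  have "(p, q) \<in> set (swap_all qs) \<Longrightarrow> form (\<lambda>i j. X j i) (J p) (I q) \<noteq> 0" for p q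
    using assms(2) by (auto simp: swap_all_def form_swap[of X])
  then show ?thesis
    unfolding leak_def
    using not_row_leak[OF assms(1,2)] not_row_leak[OF iffD2[OF kills_swap_all assms(1)]]
      models_apart[OF assms(3)] models_apart[OF assms(4)] by blast
qed

lemma row_rigid_unique:
  assumes "row_rigid d e ps" "kills X I J ps" "X \<noteq> (\<lambda>_ _. 0)" "kills Y I J ps"
    and d: "\<And>p q. d p q \<Longrightarrow> I p \<noteq> I q" and e: "\<And>p q. e p q \<Longrightarrow> J p \<noteq> J q"
  shows "\<exists>c. Y = (\<lambda>i j. c * X i j)"
proof -
  obtain p q q' a b where
    "(p, q) \<in> set ps" "(p, q') \<in> set ps" "e q q'" "(a, b) \<in> set ps" "d a p"
    using assms(1) unfolding row_rigid_def by blast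
  then show ?thesis
    using form_unique_row[of X "I p" "J q" "J q'" "I a" "J b" Y] assms(3)
      killsD[OF assms(2)] killsD[OF assms(4)] d e by blast
qed

lemma rigid_unique:
  assumes "rigid (apart D) (apart E) ps" "kills X I J ps" "X \<noteq> (\<lambda>_ _. 0)" "kills Y I J ps"
    and "models I D" "models J E"
  shows "\<exists>c. Y = (\<lambda>i j. c * X i j)"
proof -
  note d = models_apart[OF assms(5)] and e = models_apart[OF assms(6)]
  consider "row_rigid (apart D) (apart E) ps" | "row_rigid (apart E) (apart D) (swap_all ps)"
    | p q p' q' a b where "(p, q) \<in> set ps" "(p', q') \<in> set ps" "apart D p p'" "apart E q q'"
      "(a, b) \<in> set ps" "apart D p a" "apart E q' b"
    using assms(1) unfolding rigid_def by blast
  then show ?thesis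
  proof cases
    case 1
    then show ?thesis using row_rigid_unique[OF _ assms(2-4) d e] by blast
  next
    case 2
    then have "\<exists>c. (\<lambda>i j. Y j i) = (\<lambda>i j. c * X j i)"
      using row_rigid_unique[OF _ iffD2[OF kills_swap_all assms(2)]
          transpose_nonzero[OF assms(3)] iffD2[OF kills_swap_all assms(4)] e d] by blast
    then show ?thesis by (auto simp: fun_eq_iff)
  next
    case 3
    then show ?thesis
      using form_unique_distinct[of X "I p" "J q" "I p'" "J q'" "I a" "J b" Y] assms(3)
        killsD[OF assms(2)] killsD[OF assms(4)] d e by blast
  qed
qed

section \<open>Enumeration of row partitions\<close>

definition AB :: "table \<Rightarrow> side" where "AB = map (\<lambda>(a, b, c, d). (a, b))"
definition CD :: "table \<Rightarrow> side" where "CD = map (\<lambda>(a, b, c, d). (c, d))"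

text \<open>Backtracking over all ways to put each row into one of two classes; rejecting a class as
  soon as it grows keeps the search small.\<close>

fun splits :: "(table \<Rightarrow> bool) \<Rightarrow> (table \<Rightarrow> bool) \<Rightarrow> table \<Rightarrow> (table \<times> table) list" where
  "splits f g [] = [([], [])]"
| "splits f g (r # rs) = (let S = splits f g rs in
     filter (\<lambda>(K, L). \<not> f K) (map (\<lambda>(K, L). (r # K, L)) S) @
     filter (\<lambda>(K, L). \<not> g L) (map (\<lambda>(K, L). (K, r # L)) S))"

text \<open>Pruning inspects the classes of every suffix, so the tests have to accept all
  subcollections of a class and not only the whole class.\<close>

lemma filter_in_splits:
  assumes "\<And>K. set K \<subseteq> {r \<in> set rs. P r} \<Longrightarrow> \<not> f K"
    and "\<And>L. set L \<subseteq> {r \<in> set rs. \<not> P r} \<Longrightarrow> \<not> g L"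
  shows "(filter P rs, filter (\<lambda>r. \<not> P r) rs) \<in> set (splits f g rs)"
  using assms
proof (induction rs)
  case (Cons r rs)
  have IH: "(filter P rs, filter (\<lambda>r. \<not> P r) rs) \<in> set (splits f g rs)"
    by (rule Cons.IH) (use Cons.prems in auto)
  show ?case
  proof (cases "P r")
    case True
    then have "\<not> f (filter P (r # rs))" using Cons.prems(1)[of "filter P (r # rs)"] by auto
    then show ?thesis using True IH by (force simp: Let_def)
  next
    case False
    then have "\<not> g (filter (\<lambda>r. \<not> P r) (r # rs))"
      using Cons.prems(2)[of "filter (\<lambda>r. \<not> P r) (r # rs)"] by auto
    then show ?thesis using False IH by (force simp: Let_def)
  qed
qed simp

type_synonym distinctness =
  "(symbol \<times> symbol) list \<times> (symbol \<times> symbol) list \<times> (symbol \<times> symbol) list \<times> (symbol \<times> symbol) list"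

text \<open>Candidates \<open>(K, L)\<close> for the partition of the rows induced by a product vector orthogonal to
  all of them: its \<open>AB\<close> factor is orthogonal to exactly the rows in \<open>K\<close>, its \<open>CD\<close> factor at
  least to those in \<open>L\<close>.\<close>

fun flats :: "distinctness \<Rightarrow> table \<Rightarrow> (table \<times> table) list" where
  "flats (D1, D2, D3, D4) t =
     filter (\<lambda>(K, L). \<not> leak (apart D1) (apart D2) (AB K) (AB L))
       (splits (\<lambda>K. blocked (apart D1) (apart D2) (AB K))
               (\<lambda>L. blocked (apart D3) (apart D4) (CD L)) t)"

text \<open>As \<open>16\<close> is the dimension of the four-qubit space, the bound says that there
  are fewer candidates than the rank of the complement. Rigidity lets each candidate stand for at
  most one vector up to scalars.\<close>

fun certificate :: "distinctness \<Rightarrow> table \<Rightarrow> bool" where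
  "certificate (D1, D2, D3, D4) t \<longleftrightarrow>
     (let F = flats (D1, D2, D3, D4) t in length F + length t < 16 \<and>
       (\<forall>(K, L)\<in>set F. rigid (apart D1) (apart D2) (AB K) \<and> rigid (apart D3) (apart D4) (CD L)))"

text \<open>The zeros of \<open>X\<close> among the rows and the remaining rows, which
  \<open>Y\<close> must kill, form a split that survives all tests. Rigidity then makes
  \<open>tensor X Y\<close> proportional to the representative of this split.\<close>

lemma certificate_sound:
  assumes cert: "certificate (D1, D2, D3, D4) t"
    and M: "models I1 D1" "models I2 D2" "models I3 D3" "models I4 D4"
  obtains B where "finite B" "card B + length t < 16"
    "\<And>X Y. X \<noteq> (\<lambda>_ _. 0) \<Longrightarrow> Y \<noteq> (\<lambda>_ _. 0) \<Longrightarrow>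
       (\<And>a b c d. (a, b, c, d) \<in> set t \<Longrightarrow>
          form X (I1 a) (I2 b) = 0 \<or> form Y (I3 c) (I4 d) = 0) \<Longrightarrow>
       \<exists>w\<in>B. \<exists>c. tensor X Y = c *s w"
proof -
  define F where "F = flats (D1, D2, D3, D4) t"
  define T where "T = (\<lambda>(K, L). {tensor X Y |X Y. X \<noteq> (\<lambda>_ _. 0) \<and> Y \<noteq> (\<lambda>_ _. 0) \<and>
     kills X I1 I2 (AB K) \<and> kills Y I3 I4 (CD L)})"
  \<comment> \<open>One representative per candidate. If \<open>T S\<close> is empty the choice is
    arbitrary, which does not affect the bound on the cardinality.\<close>
  define B where "B = (\<lambda>S. SOME w. w \<in> T S) ` set F"
  have len: "length F + length t < 16"
    and rig: "\<And>K L. (K, L) \<in> set F \<Longrightarrow>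
      rigid (apart D1) (apart D2) (AB K) \<and> rigid (apart D3) (apart D4) (CD L)"
    using cert unfolding F_def certificate.simps Let_def by auto
  have "finite B" unfolding B_def by simp
  moreover have "card B + length t < 16"
    using len card_image_le[of "set F" "\<lambda>S. SOME w. w \<in> T S"] card_length[of F]
    unfolding B_def by simp
  moreover have "\<exists>w\<in>B. \<exists>c. tensor X Y = c *s w"
    if nz: "X \<noteq> (\<lambda>_ _. 0)" "Y \<noteq> (\<lambda>_ _. 0)"
      and cover: "\<And>a b c d. (a, b, c, d) \<in> set t \<Longrightarrow>
          form X (I1 a) (I2 b) = 0 \<or> form Y (I3 c) (I4 d) = 0" for X Y
  proof -
    \<comment> \<open>A row killed by both factors is assigned to \<open>X\<close>; the first class
      is thus the exact zero set, as the leak test demands.\<close>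
    define P where "P = (\<lambda>(a, b, c :: symbol, d :: symbol). form X (I1 a) (I2 b) = 0)"
    have kK: "kills X I1 I2 (AB K)" if "set K \<subseteq> {r \<in> set t. P r}" for K
      using that by (force simp: kills_def AB_def P_def)
    have kL: "kills Y I3 I4 (CD L)" if "set L \<subseteq> {r \<in> set t. \<not> P r}" for L
      using that cover by (fastforce simp: kills_def CD_def P_def)
    let ?K = "filter P t" and ?L = "filter (\<lambda>r. \<not> P r) t"
    have "(?K, ?L) \<in> set (splits (\<lambda>K. blocked (apart D1) (apart D2) (AB K))
               (\<lambda>L. blocked (apart D3) (apart D4) (CD L)) t)"
      by (rule filter_in_splits)
        (use not_blocked[OF kK nz(1) M(1,2)] not_blocked[OF kL nz(2) M(3,4)] in blast)+
    moreover have "\<not> leak (apart D1) (apart D2) (AB ?K) (AB ?L)"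
      by (rule not_leak[OF kK _ M(1,2)]) (auto simp: AB_def P_def)
    ultimately have F: "(?K, ?L) \<in> set F"
      unfolding F_def by simp
    have k: "kills X I1 I2 (AB ?K)" "kills Y I3 I4 (CD ?L)"
      by (auto intro: kK kL)
    then have "tensor X Y \<in> T (?K, ?L)"
      using nz by (auto simp: T_def)
    then have "(SOME w. w \<in> T (?K, ?L)) \<in> T (?K, ?L)"
      by (rule someI)
    then obtain X0 Y0 where w: "(SOME w. w \<in> T (?K, ?L)) = tensor X0 Y0"
      and nz0: "X0 \<noteq> (\<lambda>_ _. 0)" "Y0 \<noteq> (\<lambda>_ _. 0)"
      and k0: "kills X0 I1 I2 (AB ?K)" "kills Y0 I3 I4 (CD ?L)"
      by (auto simp: T_def)
    obtain c where c: "X = (\<lambda>i j. c * X0 i j)"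
      using rigid_unique[OF _ k0(1) nz0(1) k(1) M(1,2)] rig[OF F] by blast
    obtain d where d: "Y = (\<lambda>i j. d * Y0 i j)"
      using rigid_unique[OF _ k0(2) nz0(2) k(2) M(3,4)] rig[OF F] by blast
    have "tensor X Y = (c * d) *s tensor X0 Y0"
      by (simp add: c d tensor_def vec_eq_iff)
    moreover have "tensor X0 Y0 \<in> B"
      unfolding B_def w[symmetric] using F by (rule imageI)
    ultimately show ?thesis by blast
  qed
  ultimately show ?thesis by (rule that)
qed

section \<open>Complements of orthonormal product vectors\<close>

definition vcnj :: "complex ^ 'n \<Rightarrow> complex ^ 'n" where
  "vcnj u = (\<chi> i. cnj (u $ i))"

lemma cinner_simps:
  "cinner u (x + y) = cinner u x + cinner u y"
  "cinner u (x - y) = cinner u x - cinner u y"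
  "cinner u (c *s x) = c * cinner u x"
  "cinner u (r *\<^sub>R x) = of_real r * cinner u x"
  by (simp_all add: cinner_def sum.distrib sum_subtractf sum_distrib_left algebra_simps
      scaleR_conv_of_real[where 'a = complex])

lemma cinner_sum_right: "cinner u (\<Sum>j\<in>J. f j) = (\<Sum>j\<in>J. cinner u (f j))"
  by (simp add: cinner_def sum_distrib_left sum.swap[of _ UNIV])

lemma cinner_commute: "cinner u v = cnj (cinner v u)"
  by (simp add: cinner_def mult.commute)

lemma cinner_self: "cinner u u = of_real ((norm u)\<^sup>2)"
proof -
  have "cinner u u = (\<Sum>k\<in>UNIV. of_real ((cmod (u $ k))\<^sup>2))"
    unfolding cinner_def
    by (intro sum.cong) (simp_all add: complex_norm_square mult.commute del: of_real_power)
  also have "\<dots> = of_real ((norm u)\<^sup>2)"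
    by (simp add: norm_vec_def L2_set_def sum_nonneg)
  finally show ?thesis .
qed

lemma cinner_unit: "norm u = 1 \<Longrightarrow> cinner u u = 1"
  by (simp add: cinner_self)

lemma proj_mult: "proj v *v x = cinner v x *s v"
  by (simp add: proj_def matrix_vector_mult_def cinner_def vec_eq_iff sum_distrib_left
      algebra_simps)

lemma trace_proj: "trace (proj v) = cinner v v"
  by (simp add: trace_def proj_def cinner_def mult.commute)

lemma scaleR_matrix_vector: "(r *\<^sub>R M) *v x = r *\<^sub>R (M *v x)" for M :: "complex ^ 'n ^ 'm"
  by (simp add: matrix_vector_mult_def vec_eq_iff scaleR_right.sum)

lemma sum_matrix_vector: "(\<Sum>j\<in>J. M j) *v x = (\<Sum>j\<in>J. M j *v x)"
  by (induction J rule: infinite_finite_induct) (simp_all add: matrix_vector_mult_add_rdistrib)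

lemma psd_scaleR: "psd M \<Longrightarrow> 0 \<le> r \<Longrightarrow> psd (r *\<^sub>R M)"
  by (auto simp: psd_def scaleR_matrix_vector cinner_simps complex_nonneg_Reals_iff)

section \<open>The complementary projector: positivity, trace and rank\<close>

definition orthonormal :: "'j set \<Rightarrow> ('j \<Rightarrow> complex ^ 'n) \<Rightarrow> bool" where
  "orthonormal J v \<longleftrightarrow> finite J \<and> (\<forall>i\<in>J. \<forall>j\<in>J. cinner (v i) (v j) = (if i = j then 1 else 0))"

definition complement :: "'j set \<Rightarrow> ('j \<Rightarrow> complex ^ 'n) \<Rightarrow> complex ^ 'n ^ 'n" where
  "complement J v = mat 1 - (\<Sum>j\<in>J. proj (v j))"

lemma complement_mult: "complement J v *v x = x - (\<Sum>j\<in>J. cinner (v j) x *s v j)"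
  by (simp add: complement_def matrix_vector_mult_diff_rdistrib sum_matrix_vector proj_mult)

lemma cinner_sum_orthonormal:
  assumes "orthonormal J v" "i \<in> J"
  shows "cinner (v i) (\<Sum>j\<in>J. f j *s v j) = f i"
proof -
  have "cinner (v i) (\<Sum>j\<in>J. f j *s v j) = (\<Sum>j\<in>J. if j = i then f j else 0)"
    unfolding cinner_sum_right
    using assms by (intro sum.cong) (auto simp: cinner_simps orthonormal_def)
  then show ?thesis using assms by (simp add: orthonormal_def)
qed

lemma cinner_complement:
  assumes "orthonormal J v" "i \<in> J"
  shows "cinner (v i) (complement J v *v x) = 0"
  by (simp add: complement_mult cinner_simps cinner_sum_orthonormal[OF assms])

text \<open>The complement is an orthogonal projector: \<open>x\<close> differs from its image
  \<open>?y\<close> by a combination of the \<open>v j\<close>, all orthogonal to \<open>?y\<close>,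
  so the quadratic form equals the squared norm of \<open>?y\<close>.\<close>

lemma psd_complement:
  assumes "orthonormal J v"
  shows "psd (complement J v)"
  unfolding psd_def
proof
  fix x
  let ?y = "complement J v *v x"
  have "cinner x ?y = cnj (cinner ?y (?y + (\<Sum>j\<in>J. cinner (v j) x *s v j)))"
    by (subst cinner_commute) (simp add: complement_mult)
  also have "\<dots> = cnj (cinner ?y ?y)"
  proof -
    have "cinner ?y (v j) = 0" if "j \<in> J" for j
      by (metis cinner_commute cinner_complement[OF assms that] complex_cnj_zero)
    then show ?thesis by (simp add: cinner_simps cinner_sum_right)
  qed
  also have "\<dots> = of_real ((norm ?y)\<^sup>2)"
    by (simp add: cinner_self)
  finally show "cinner x ?y \<in> \<real>\<^sub>\<ge>\<^sub>0" by simp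
qed

lemma trace_complement:
  fixes v :: "'j \<Rightarrow> complex ^ 'n"
  assumes "orthonormal J v"
  shows "trace (complement J v) = of_nat CARD('n) - of_nat (card J)"
proof -
  have "trace (\<Sum>j\<in>J. proj (v j)) = (\<Sum>j\<in>J. trace (proj (v j)))"
    by (simp add: trace_def sum.swap[of _ UNIV])
  also have "\<dots> = of_nat (card J)"
    using assms by (simp add: trace_proj orthonormal_def)
  finally show ?thesis
    by (simp add: complement_def trace_sub trace_I)
qed

lemma cinner_vcnj: "cinner (vcnj u) (vcnj v) = cnj (cinner u v)"
  by (simp add: cinner_def vcnj_def)

lemma row_complement:
  "row k (complement J v) = axis k 1 - (\<Sum>j\<in>J. (v j $ k) *s vcnj (v j))"
  by (simp add: complement_def vec_eq_iff row_def proj_def vcnj_def mat_def axis_def)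

text \<open>The rank is the dimension of the row space \<open>?S\<close>. It is orthogonal to the
  span \<open>?T\<close> of the conjugated family, and both together span everything, so the
  dimension formula applies.\<close>

lemma rank_scaled_complement:
  fixes v :: "'j \<Rightarrow> complex ^ 'n"
  assumes ortho: "orthonormal J v" and r: "r \<noteq> 0"
  shows "rank (r *\<^sub>R complement J v) = CARD('n) - card J"
proof -
  let ?M = "r *\<^sub>R complement J v" and ?u = "\<lambda>j. vcnj (v j)"
  let ?S = "vec.span (rows ?M)" and ?T = "vec.span (?u ` J)"
  have fin: "finite J" using ortho by (simp add: orthonormal_def)
  have ortho': "orthonormal J ?u"
    using ortho by (auto simp: orthonormal_def cinner_vcnj)
  have row: "row k ?M = complex_of_real r *s (axis k 1 - (\<Sum>j\<in>J. (v j $ k) *s ?u j))" for k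
    by (simp add: row_complement[symmetric] row_def vec_eq_iff
        scaleR_conv_of_real[where 'a = complex])
  have inj: "inj_on ?u J"
    using ortho' unfolding orthonormal_def inj_on_def by (metis one_neq_zero)
  have ind: "vec.independent (?u ` J)"
  proof (rule vec.independent_if_scalars_zero)
    show "finite (?u ` J)" using fin by simp
    fix f x
    assume z: "(\<Sum>x\<in>?u ` J. f x *s x) = 0" and "x \<in> ?u ` J"
    then obtain i where i: "i \<in> J" "x = ?u i" by blast
    have "(\<Sum>j\<in>J. f (?u j) *s ?u j) = 0"
      using z inj by (simp add: sum.reindex)
    then have "cinner (?u i) (\<Sum>j\<in>J. f (?u j) *s ?u j) = 0"
      by (simp add: cinner_def)
    then show "f x = 0"
      using cinner_sum_orthonormal[OF ortho' i(1), of "\<lambda>j. f (?u j)"] i by simp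
  qed
  have dimT: "vec.dim ?T = card J"
    using vec.dim_span_eq_card_independent[OF ind] card_image[OF inj] by simp
  have orth: "cinner (?u i) x = 0" if "x \<in> ?S" "i \<in> J" for x i
    using that(1)
  proof (induction rule: vec.span_induct_alt)
    case (step c x y)
    then obtain k where "x = row k ?M" by (auto simp: rows_def)
    moreover have "cinner (?u i) (axis k 1 - (\<Sum>j\<in>J. (v j $ k) *s ?u j)) = 0"
      using cinner_sum_orthonormal[OF ortho' that(2), of "\<lambda>j. v j $ k"]
      by (simp add: cinner_simps) (simp add: cinner_def vcnj_def axis_def if_distrib cong: if_cong)
    ultimately show ?case using step by (simp add: row cinner_simps)
  qed (simp add: cinner_def)
  have "?S \<inter> ?T = {0}"
  proof -
    have "x = 0" if x: "x \<in> ?S" "x \<in> ?T" for x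
    proof -
      obtain f where "x = (\<Sum>w\<in>?u ` J. f w *s w)"
        using x(2) fin by (auto simp: vec.span_finite)
      then have f: "x = (\<Sum>j\<in>J. f (?u j) *s ?u j)"
        using inj by (simp add: sum.reindex)
      have "f (?u i) = 0" if "i \<in> J" for i
        using orth[OF x(1) that] cinner_sum_orthonormal[OF ortho' that, of "\<lambda>j. f (?u j)"] f by simp
      then show "x = 0" by (simp add: f)
    qed
    then show ?thesis by (auto simp: vec.span_zero)
  qed
  moreover have "{x + y |x y. x \<in> ?S \<and> y \<in> ?T} = UNIV"
  proof -
    have sub: "vec.subspace {x + y |x y. x \<in> ?S \<and> y \<in> ?T}"
      by (rule vec.subspace_sums) simp_all
    have "axis k 1 \<in> {x + y |x y. x \<in> ?S \<and> y \<in> ?T}" for k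
    proof -
      \<comment> \<open>Solving the formula for the row: each coordinate vector is a rescaled row
        plus an element of \<open>?T\<close>.\<close>
      have "axis k 1 = (1 / complex_of_real r) *s row k ?M + (\<Sum>j\<in>J. (v j $ k) *s ?u j)"
        using r by (simp add: row vector_ssub_ldistrib)
      moreover have "(1 / complex_of_real r) *s row k ?M \<in> ?S"
        by (intro vec.span_scale vec.span_base) (auto simp: rows_def)
      moreover have "(\<Sum>j\<in>J. (v j $ k) *s ?u j) \<in> ?T"
        by (intro vec.span_sum vec.span_scale vec.span_base) auto
      ultimately show ?thesis by blast
    qed
    then have "cart_basis \<subseteq> {x + y |x y. x \<in> ?S \<and> y \<in> ?T}"
      by (auto simp: cart_basis_def)
    then have "vec.span cart_basis \<subseteq> {x + y |x y. x \<in> ?S \<and> y \<in> ?T}"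
      using sub by (rule vec.span_minimal)
    then show ?thesis by (simp add: vec.span_Basis top.extremum_unique)
  qed
  moreover have "vec.dim {x + y |x y. x \<in> ?S \<and> y \<in> ?T} + vec.dim (?S \<inter> ?T) = vec.dim ?S + vec.dim ?T"
    by (rule vec.dim_sums_Int) simp_all
  ultimately have "CARD('n) = vec.dim ?S + card J"
    by (simp add: dimT card_cart_basis del: vec.dim_span)
  then show ?thesis
    by (simp add: row_rank_def_gen)
qed

text \<open>Range criterion: each product vector of positive weight in a separable decomposition is
  orthogonal to all \<open>v j\<close>, hence a multiple of an element of \<open>B\<close>. The rows
  of \<open>M\<close> would lie in a span of too few vectors.\<close>

lemma entangled_if_few_product_vectors:
  fixes v :: "'j \<Rightarrow> vec4"
  assumes ortho: "orthonormal J v" and fin: "finite B" and card: "card B < rank M"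
    and M: "M = r *\<^sub>R complement J v"
    and B: "\<And>w. product_vector P w \<Longrightarrow> w \<noteq> 0 \<Longrightarrow> (\<And>j. j \<in> J \<Longrightarrow> cinner (v j) w = 0) \<Longrightarrow>
      \<exists>b\<in>B. \<exists>c. w = c *s b"
  shows "entangled P M"
  unfolding entangled_def
proof
  assume "M \<in> convex hull {proj w |w. product_vector P w \<and> norm w = 1}"
  then obtain S u where S: "finite S" "S \<subseteq> {proj w |w. product_vector P w \<and> norm w = 1}"
    and u: "\<forall>A\<in>S. 0 \<le> u A" and Mu: "(\<Sum>A\<in>S. u A *\<^sub>R A) = M"
    unfolding convex_hull_explicit by blast
  have rowA: "row k (u A *\<^sub>R A) \<in> vec.span (vcnj ` B)" if A: "A \<in> S" for A k
  proof (cases "u A = 0")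
    \<comment> \<open>A term of weight zero need not satisfy the orthogonality, but its rows
      vanish.\<close>
    case True
    have "row k (u A *\<^sub>R A) = 0" by (simp add: True row_def vec_eq_iff)
    then show ?thesis by (simp add: vec.span_zero)
  next
    case False
    obtain w where w: "A = proj w" "product_vector P w" "norm w = 1"
      using subsetD[OF S(2) A] by auto
    have "cinner (v j) w = 0" if "j \<in> J" for j
    proof -
      \<comment> \<open>The expectation of \<open>M\<close> at \<open>v j\<close> is zero, while
        every summand has nonnegative expectation; so each term of positive weight has expectation
        zero.\<close>
      have q: "Re (cinner (v j) (C *v v j)) \<ge> 0" if "C \<in> S" for C
      proof -
        obtain x where "C = proj x" using subsetD[OF S(2) \<open>C \<in> S\<close>] by auto
        then have "cinner (v j) (C *v v j) = cinner x (v j) * cnj (cinner x (v j))"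
          using cinner_commute[of "v j" x] by (simp add: proj_mult cinner_simps)
        then show ?thesis by simp
      qed
      have "complement J v *v v j = 0"
        using ortho that by (simp add: complement_mult orthonormal_def if_distrib[of "\<lambda>c. c *s _"] sum.delta' cong: if_cong)
      then have "Re (cinner (v j) (M *v v j)) = 0"
        by (simp add: M scaleR_matrix_vector cinner_simps) (simp add: cinner_def)
      then have "(\<Sum>C\<in>S. u C * Re (cinner (v j) (C *v v j))) = 0"
        by (simp add: Mu[symmetric] sum_matrix_vector cinner_sum_right scaleR_matrix_vector cinner_simps)
      then have "u A * Re (cinner (v j) (A *v v j)) = 0"
        using sum_nonneg_eq_0_iff[OF S(1), of "\<lambda>C. u C * Re (cinner (v j) (C *v v j))"] u q \<open>A \<in> S\<close>
        by simp
      then have "Re (cinner (v j) (A *v v j)) = 0" using False by simp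
      moreover have "cinner (v j) (A *v v j) = of_real ((cmod (cinner w (v j)))\<^sup>2)"
        using cinner_commute[of "v j" w]
        by (simp add: w proj_mult cinner_simps complex_norm_square del: of_real_power)
      ultimately show ?thesis
        using cinner_commute[of "v j" w] by simp
    qed
    then obtain b c where "b \<in> B" "w = c *s b"
      using B[OF w(2)] w(3) by fastforce
    \<comment> \<open>Rows of a projector are multiples of the conjugated vector, which is why
      \<open>vcnj\<close> enters.\<close>
    then have "row k (u A *\<^sub>R A) = (of_real (u A) * w $ k * cnj c) *s vcnj b"
      by (simp add: row_def vec_eq_iff w(1) proj_def vcnj_def scaleR_conv_of_real[where 'a = complex])
    then show ?thesis
      using \<open>b \<in> B\<close> by (simp add: vec.span_scale vec.span_base)
  qed
  have "row k M = (\<Sum>A\<in>S. row k (u A *\<^sub>R A))" for k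
    by (simp add: Mu[symmetric] row_def vec_eq_iff)
  then have "rows M \<subseteq> vec.span (vcnj ` B)"
    using rowA by (auto simp: rows_def intro!: vec.span_sum)
  then have "rank M \<le> card (vcnj ` B)"
    unfolding row_rank_def_gen using fin by (intro vec.dim_le_card) auto
  then show False
    using card card_image_le[OF fin, of vcnj] by linarith
qed

section \<open>Product vectors of four qubits\<close>

lemma UNIV_qubit: "(UNIV :: qubit set) = {qA, qB, qC, qD}"
  using qubit.exhaust by blast

lemma card_index: "CARD(index) = 16"
  by (simp add: card_fun UNIV_qubit)

lemma sum_index:
  "(\<Sum>x\<in>(UNIV :: index set). f (x qA) (x qB) (x qC) (x qD)) =
     (\<Sum>i\<in>UNIV. \<Sum>j\<in>UNIV. \<Sum>k\<in>UNIV. \<Sum>l\<in>UNIV. f i j k l)"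
proof -
  let ?g = "\<lambda>(i, j, k, l). case_qubit i j k l"
  have "(\<Sum>x\<in>(UNIV :: index set). f (x qA) (x qB) (x qC) (x qD)) =
      (\<Sum>(i, j, k, l)\<in>UNIV. f i j k l)"
    by (rule sum.reindex_bij_witness[of _ ?g "\<lambda>x. (x qA, x qB, x qC, x qD)"])
      (auto simp: fun_eq_iff split: qubit.split)
  then show ?thesis
    by (simp add: UNIV_Times_UNIV[symmetric] sum.cartesian_product del: UNIV_Times_UNIV)
qed

lemma sum_product_4:
  fixes f g h k :: "'a \<Rightarrow> complex"
  shows "(\<Sum>i\<in>A. \<Sum>j\<in>B. \<Sum>l\<in>C. \<Sum>m\<in>D. F i j * G l m) =
    (\<Sum>i\<in>A. \<Sum>j\<in>B. F i j :: complex) * (\<Sum>l\<in>C. \<Sum>m\<in>D. G l m)"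
  by (simp only: sum_distrib_left[symmetric] sum_distrib_right[symmetric])

text \<open>The factorisation turns orthogonality into an alternative between the AB and the CD
  factor, the source of the row partitions.\<close>

lemma cinner_row_tensor:
  "cinner (row_vector (a, b, c, d)) (tensor X Y) =
     (\<Sum>i\<in>UNIV. \<Sum>j\<in>UNIV. X i j * cnj (a $ i) * cnj (b $ j)) *
     (\<Sum>i\<in>UNIV. \<Sum>j\<in>UNIV. Y i j * cnj (c $ i) * cnj (d $ j))"
proof -
  have "cinner (row_vector (a, b, c, d)) (tensor X Y) =
    (\<Sum>i\<in>UNIV. \<Sum>j\<in>UNIV. \<Sum>k\<in>UNIV. \<Sum>l\<in>UNIV.
      (X i j * cnj (a $ i) * cnj (b $ j)) * (Y k l * cnj (c $ k) * cnj (d $ l)))"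
    by (simp add: cinner_def tensor_def algebra_simps flip: sum_index)
  then show ?thesis
    by (simp only: sum_product_4)
qed

lemma row_vector_tensor:
  "row_vector (a, b, c, d) = tensor (\<lambda>i j. a $ i * b $ j) (\<lambda>i j. c $ i * d $ j)"
  by (simp add: tensor_def vec_eq_iff algebra_simps)

lemma cinner_row_row:
  "cinner (row_vector (a, b, c, d)) (row_vector (a', b', c', d')) =
     cinner a a' * cinner b b' * cinner c c' * cinner d d'"
  unfolding row_vector_tensor[of a'] cinner_row_tensor
  by (simp add: cinner_def sum_2 algebra_simps)

lemma form_point_of:
  assumes "a \<noteq> 0" "b \<noteq> 0"
    and "(\<Sum>i\<in>UNIV. \<Sum>j\<in>UNIV. X i j * cnj (a $ i) * cnj (b $ j)) = 0"
  shows "form X (point_of a) (point_of b) = 0"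
proof -
  obtain s where s: "s \<noteq> 0" "\<And>i. cnj (a $ i) = s * hom (point_of a) i"
    using hom_point_of[OF assms(1)] by metis
  obtain t where t: "t \<noteq> 0" "\<And>i. cnj (b $ i) = t * hom (point_of b) i"
    using hom_point_of[OF assms(2)] by metis
  have "s * t * form X (point_of a) (point_of b) = 0"
    using assms(3) by (simp add: s(2) t(2) form_def sum_distrib_left algebra_simps)
  then show ?thesis using s(1) t(1) by simp
qed

lemma cinner_eq_0_if_antipode:
  assumes "u \<noteq> 0" "v \<noteq> 0" "point_of u = antipode (point_of v)"
  shows "cinner u v = 0"
proof -
  obtain s where s: "s \<noteq> 0" "\<And>i. cnj (u $ i) = s * hom (point_of u) i"
    using hom_point_of[OF assms(1)] by metis
  obtain t where t: "t \<noteq> 0" "\<And>i. cnj (v $ i) = t * hom (point_of v) i"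
    using hom_point_of[OF assms(2)] by metis
  obtain c where c: "hom (antipode (point_of v)) 1 = - c * cnj (hom (point_of v) 2)"
    "hom (antipode (point_of v)) 2 = c * cnj (hom (point_of v) 1)"
    by (rule hom_antipode)
  have "v $ i = cnj t * cnj (hom (point_of v) i)" for i
    by (metis t(2) complex_cnj_cnj complex_cnj_mult)
  then show ?thesis
    unfolding cinner_def s(2) assms(3) sum_2 by (simp add: c)
qed

text \<open>All three systems refine, or equal, the cut AB|CD, so one count of vectors
  \<open>tensor X Y\<close> serves them all.\<close>

lemma product_vector_tensor:
  assumes "product_vector P w" "P \<in> {sys_4qubit, sys_2x2x4, sys_4x4}"
  obtains X Y where "w = tensor X Y"
proof -
  obtain f where f: "\<And>x. w $ x = (\<Prod>G\<in>P. f G (restrict x G))"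
    using assms(1) by (auto simp: product_vector_def)
  \<comment> \<open>Explicit forms of restricted index functions, which are \<open>undefined\<close>
    outside the block.\<close>
  define one where "one q i = (\<lambda>r. if r = q then i else undefined)" for q :: qubit and i :: 2
  define two where "two q q' i j = (\<lambda>r. if r = q then i else if r = q' then j else undefined)"
    for q q' :: qubit and i j :: 2
  have r1: "restrict x {q} = one q (x q)" for x q
    by (auto simp: one_def)
  have r2: "restrict x {q, q'} = two q q' (x q) (x q')" for x q q'
    by (auto simp: two_def)
  consider "P = sys_4qubit" | "P = sys_2x2x4" | "P = sys_4x4" using assms(2) by blast
  then show ?thesis
  proof cases
    case 1
    have "w = tensor (\<lambda>i j. f {qA} (one qA i) * f {qB} (one qB j))
        (\<lambda>i j. f {qC} (one qC i) * f {qD} (one qD j))"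
      by (simp add: vec_eq_iff f 1 sys_4qubit_def tensor_def r1 algebra_simps)
    then show ?thesis by (rule that)
  next
    case 2
    \<comment> \<open>Distinct blocks let the product over the set \<open>P\<close> split into one
      factor per block.\<close>
    have "{qA} \<noteq> {qC, qD}" "{qB} \<noteq> {qC, qD}" by auto
    then have "w = tensor (\<lambda>i j. f {qA} (one qA i) * f {qB} (one qB j))
        (\<lambda>i j. f {qC, qD} (two qC qD i j))"
      by (simp add: vec_eq_iff f 2 sys_2x2x4_def tensor_def r1 r2 algebra_simps)
    then show ?thesis by (rule that)
  next
    case 3
    have "{qA, qB} \<noteq> {qC, qD}" by auto
    then have "w = tensor (\<lambda>i j. f {qA, qB} (two qA qB i j)) (\<lambda>i j. f {qC, qD} (two qC qD i j))"
      by (simp add: vec_eq_iff f 3 sys_4x4_def tensor_def r2)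
    then show ?thesis by (rule that)
  qed
qed

section \<open>Partial transposes of projectors onto rows\<close>

fun cnj_row :: "qubit set \<Rightarrow> row \<Rightarrow> row" where
  "cnj_row S (a, b, c, d) = (if qA \<in> S then vcnj a else a, if qB \<in> S then vcnj b else b,
     if qC \<in> S then vcnj c else c, if qD \<in> S then vcnj d else d)"

lemma partial_transpose_proj_row:
  "partial_transpose S (proj (row_vector r)) = proj (row_vector (cnj_row S r))"
  by (cases r) (simp add: partial_transpose_def proj_def vec_eq_iff override_on_def vcnj_def)

lemma partial_transpose_mat_1: "partial_transpose S (mat 1) = mat 1"
proof -
  have "override_on x y S = override_on y x S \<longleftrightarrow> x = y" for x y :: index
    by (auto simp: fun_eq_iff override_on_def split: if_splits)
  then show ?thesis by (simp add: partial_transpose_def mat_def vec_eq_iff)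
qed

lemma partial_transpose_scaled_complement:
  "partial_transpose S (r *\<^sub>R complement J row_vector) =
     r *\<^sub>R complement J (\<lambda>j. row_vector (cnj_row S j))"
proof -
  have "partial_transpose S (r *\<^sub>R complement J row_vector) =
     r *\<^sub>R (partial_transpose S (mat 1) - (\<Sum>j\<in>J. partial_transpose S (proj (row_vector j))))"
    by (simp add: complement_def partial_transpose_def vec_eq_iff)
  then show ?thesis
    by (simp add: partial_transpose_mat_1 partial_transpose_proj_row complement_def)
qed

fun perpendicular :: "row \<Rightarrow> row \<Rightarrow> bool" where
  "perpendicular (a, b, c, d) (a', b', c', d') \<longleftrightarrow>
     cinner a a' = 0 \<or> cinner b b' = 0 \<or> cinner c c' = 0 \<or> cinner d d' = 0"

fun unit_row :: "row \<Rightarrow> bool" where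
  "unit_row (a, b, c, d) \<longleftrightarrow> norm a = 1 \<and> norm b = 1 \<and> norm c = 1 \<and> norm d = 1"

text \<open>Orthogonality of two rows is witnessed by a column, and conjugating that column keeps
  its inner product zero. Hence every partial transpose is again a complement of an orthonormal
  family.\<close>

lemma orthonormal_cnj_row:
  assumes "finite J" "\<And>r. r \<in> J \<Longrightarrow> unit_row r"
    and "\<And>r r'. r \<in> J \<Longrightarrow> r' \<in> J \<Longrightarrow> r \<noteq> r' \<Longrightarrow> perpendicular r r'"
  shows "orthonormal J (\<lambda>r. row_vector (cnj_row S r))"
proof -
  have "cinner (row_vector (cnj_row S r)) (row_vector (cnj_row S r)) = 1" if "r \<in> J" for r
    using assms(2)[OF that]
    by (cases r) (simp add: cinner_row_row cinner_vcnj cinner_unit del: row_vector.simps)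
  moreover have "cinner (row_vector (cnj_row S r)) (row_vector (cnj_row S r')) = 0"
    if "r \<in> J" "r' \<in> J" "r \<noteq> r'" for r r'
    using assms(3)[OF that] by (cases r; cases r') (auto simp: cinner_row_row cinner_vcnj simp del: row_vector.simps)
  ultimately show ?thesis using assms(1) by (auto simp: orthonormal_def)
qed

lemma cnj_row_empty [simp]: "cnj_row {} r = r"
  by (cases r) simp

section \<open>From certified tables to entangled states\<close>

fun orthogonal_symbols ::
  "symbol \<times> symbol \<times> symbol \<times> symbol \<Rightarrow> symbol \<times> symbol \<times> symbol \<times> symbol \<Rightarrow> bool" where
  "orthogonal_symbols (p, q, r, s) (p', q', r', s') \<longleftrightarrow>
     p = dual p' \<or> q = dual q' \<or> r = dual r' \<or> s = dual s'"

definition realizes :: "(symbol \<Rightarrow> point) \<Rightarrow> (symbol \<Rightarrow> point) \<Rightarrow> (symbol \<Rightarrow> point) \<Rightarrow>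
    (symbol \<Rightarrow> point) \<Rightarrow> row list \<Rightarrow> table \<Rightarrow> bool" where
  "realizes I1 I2 I3 I4 R t \<longleftrightarrow>
     list_all2 (\<lambda>(a, b, c, d) (p, q, r, s). unit_row (a, b, c, d) \<and> point_of a = I1 p \<and>
       point_of b = I2 q \<and> point_of c = I3 r \<and> point_of d = I4 s) R t"

definition PPT_entangled_of_rank :: "nat \<Rightarrow> op4 \<Rightarrow> bool" where
  "PPT_entangled_of_rank n M \<longleftrightarrow> PPT_entangled_state sys_4qubit M \<and>
     PPT_entangled_state sys_2x2x4 M \<and> PPT_entangled_state sys_4x4 M \<and> rank M = n"

definition complement_PPT_entangled :: "nat \<Rightarrow> vec4 set \<Rightarrow> bool" where
  "complement_PPT_entangled n U \<longleftrightarrow>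
     PPT_entangled_of_rank n ((1 / real n) *\<^sub>R (mat 1 - (\<Sum>\<psi>\<in>U. proj \<psi>)))"

lemma perpendicular_sym: "perpendicular r r' \<Longrightarrow> perpendicular r' r"
proof -
  have "cinner u v = 0 \<Longrightarrow> cinner v u = 0" for u v :: qvec
    by (metis cinner_commute complex_cnj_zero)
  then show "perpendicular r r' \<Longrightarrow> perpendicular r' r"
    by (cases r; cases r') auto
qed

lemma unit_row_not_perpendicular: "unit_row r \<Longrightarrow> \<not> perpendicular r r"
  by (cases r) (auto simp: cinner_unit)

lemma perpendicular_if_orthogonal_symbols:
  assumes "models I1 D1" "models I2 D2" "models I3 D3" "models I4 D4"
    and "unit_row (a, b, c, d)" "unit_row (a', b', c', d')"
    and "point_of a = I1 p" "point_of b = I2 q" "point_of c = I3 r" "point_of d = I4 s"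
    and "point_of a' = I1 p'" "point_of b' = I2 q'" "point_of c' = I3 r'" "point_of d' = I4 s'"
    and "orthogonal_symbols (p, q, r, s) (p', q', r', s')"
  shows "perpendicular (a, b, c, d) (a', b', c', d')"
proof -
  have nz: "a \<noteq> 0" "b \<noteq> 0" "c \<noteq> 0" "d \<noteq> 0" "a' \<noteq> 0" "b' \<noteq> 0" "c' \<noteq> 0" "d' \<noteq> 0"
    using assms(5,6) by auto
  show ?thesis
    using assms(15) cinner_eq_0_if_antipode[of a a'] cinner_eq_0_if_antipode[of b b']
      cinner_eq_0_if_antipode[of c c'] cinner_eq_0_if_antipode[of d d'] nz assms(7-14)
      models_dual[OF assms(1)] models_dual[OF assms(2)] models_dual[OF assms(3)]
      models_dual[OF assms(4)]
    by auto
qed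

text \<open>The symbols give perpendicularity for increasing positions, and symmetry does the rest.
  A unit row is not perpendicular to itself, whence distinctness.\<close>

lemma realizes_rows:
  assumes "models I1 D1" "models I2 D2" "models I3 D3" "models I4 D4"
    and R: "realizes I1 I2 I3 I4 R t" and t: "sorted_wrt orthogonal_symbols t"
  shows "distinct R" "\<And>r. r \<in> set R \<Longrightarrow> unit_row r"
    "\<And>r r'. r \<in> set R \<Longrightarrow> r' \<in> set R \<Longrightarrow> r \<noteq> r' \<Longrightarrow> perpendicular r r'"
proof -
  have len: "length R = length t"
    using R unfolding realizes_def by (rule list_all2_lengthD)
  have perp: "perpendicular (R ! i) (R ! j)" if "i < j" "j < length R" for i j
  proof -
    obtain a b c d p q r s a' b' c' d' p' q' r' s' where e:
      "R ! i = (a, b, c, d)" "t ! i = (p, q, r, s)"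
      "R ! j = (a', b', c', d')" "t ! j = (p', q', r', s')"
      by (metis prod_cases4)
    have "orthogonal_symbols (t ! i) (t ! j)"
      using t that len by (simp add: sorted_wrt_iff_nth_less)
    then show ?thesis
      using perpendicular_if_orthogonal_symbols[OF assms(1-4)]
        list_all2_nthD[OF R[unfolded realizes_def] that(2)]
        list_all2_nthD[OF R[unfolded realizes_def] less_trans[OF that]]
      unfolding e by auto
  qed
  show unit: "unit_row r" if "r \<in> set R" for r
  proof -
    obtain i where "i < length R" "r = R ! i" using \<open>r \<in> set R\<close> by (metis in_set_conv_nth)
    then show ?thesis
      using list_all2_nthD[OF R[unfolded realizes_def], of i] by (auto split: prod.splits)
  qed
  show "distinct R"
    unfolding distinct_conv_nth
    using perp unit unit_row_not_perpendicular by (metis linorder_neqE_nat nth_mem)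
  show "perpendicular r r'" if "r \<in> set R" "r' \<in> set R" "r \<noteq> r'" for r r'
    using that perp perpendicular_sym by (metis in_set_conv_nth linorder_neqE_nat)
qed

text \<open>PPT holds because all partial transposes are scaled complements; entanglement combines
  the range criterion with the finite set supplied by the certificate.\<close>

lemma certified_state:
  assumes cert: "certificate (D1, D2, D3, D4) t"
    and M: "models I1 D1" "models I2 D2" "models I3 D3" "models I4 D4"
    and R: "realizes I1 I2 I3 I4 R t" and t: "sorted_wrt orthogonal_symbols t"
  shows "complement_PPT_entangled (16 - length t) (row_vectors R)"
proof -
  note rows = realizes_rows[OF M R t]
  have ortho: "orthonormal (set R) (\<lambda>r. row_vector (cnj_row S r))" for S
    by (rule orthonormal_cnj_row) (use rows in auto)
  have ortho0: "orthonormal (set R) row_vector"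
    using ortho[of "{}"] by simp
  have inj: "inj_on row_vector (set R)"
    using ortho0 unfolding orthonormal_def inj_on_def by (metis one_neq_zero)
  have cardR: "card (set R) = length t"
    using distinct_card[OF rows(1)] list_all2_lengthD[OF R[unfolded realizes_def]] by simp
  define n where "n = 16 - length t"
  obtain B where B: "finite B" "card B + length t < 16"
    "\<And>X Y. X \<noteq> (\<lambda>_ _. 0) \<Longrightarrow> Y \<noteq> (\<lambda>_ _. 0) \<Longrightarrow>
       (\<And>a b c d. (a, b, c, d) \<in> set t \<Longrightarrow>
          form X (I1 a) (I2 b) = 0 \<or> form Y (I3 c) (I4 d) = 0) \<Longrightarrow>
       \<exists>w\<in>B. \<exists>c. tensor X Y = c *s w"
    by (rule certificate_sound[OF cert M]) blast
  have n: "n > 0" "length t \<le> 16" using B(2) by (simp_all add: n_def)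
  let ?M = "(1 / real n) *\<^sub>R complement (set R) row_vector"
  \<comment> \<open>The operator sums over a set of vectors; injectivity permits summing over the
    rows instead.\<close>
  have M_eq: "(1 / real n) *\<^sub>R (mat 1 - (\<Sum>\<psi>\<in>row_vectors R. proj \<psi>)) = ?M"
    using inj by (simp add: complement_def row_vectors_def sum.reindex)
  have rank: "rank ?M = n"
    using rank_scaled_complement[OF ortho0, of "1 / real n"] n
    by (simp add: card_index cardR n_def)
  have pt: "psd (partial_transpose S ?M)" for S
    unfolding partial_transpose_scaled_complement
    by (intro psd_scaleR psd_complement ortho) simp
  have tr: "trace (complement (set R) row_vector) = of_nat n"
    using n trace_complement[OF ortho0] by (simp add: card_index cardR n_def of_nat_diff)
  have "trace ?M = (1 / of_nat n) * trace (complement (set R) row_vector)"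
    by (simp add: trace_def sum_distrib_left scaleR_conv_of_real[where 'a = complex] sum_divide_distrib)
  also have "\<dots> = 1"
    using n by (simp add: tr)
  finally have dens: "density_operator ?M"
    using psd_scaleR[OF psd_complement[OF ortho0], of "1 / real n"]
    by (simp add: density_operator_def)
  have ent: "entangled P ?M" if P: "P \<in> {sys_4qubit, sys_2x2x4, sys_4x4}" for P
  proof (rule entangled_if_few_product_vectors[OF ortho0 B(1) _ refl])
    show "card B < rank ?M" unfolding rank using B(2) by (simp add: n_def)
    fix w
    assume w: "product_vector P w" "w \<noteq> 0" "\<And>r. r \<in> set R \<Longrightarrow> cinner (row_vector r) w = 0"
    obtain X Y where XY: "w = tensor X Y"
      using product_vector_tensor[OF w(1) P] by blast
    have "X \<noteq> (\<lambda>_ _. 0)" "Y \<noteq> (\<lambda>_ _. 0)"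
      using w(2) by (auto simp: XY tensor_def vec_eq_iff)
    moreover have "form X (I1 p) (I2 q) = 0 \<or> form Y (I3 r) (I4 s) = 0"
      if pqrs: "(p, q, r, s) \<in> set t" for p q r s
    proof -
      obtain i where i: "i < length t" "t ! i = (p, q, r, s)"
        using pqrs unfolding in_set_conv_nth by blast
      then have i': "i < length R" using list_all2_lengthD[OF R[unfolded realizes_def]] by argo
      obtain a b c d where Ri: "R ! i = (a, b, c, d)" by (metis prod_cases4)
      have u: "unit_row (a, b, c, d)" and pts: "point_of a = I1 p" "point_of b = I2 q"
        "point_of c = I3 r" "point_of d = I4 s"
        using list_all2_nthD[OF R[unfolded realizes_def] i'] i(2) Ri by auto
      have nz: "a \<noteq> 0" "b \<noteq> 0" "c \<noteq> 0" "d \<noteq> 0" using u by auto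
      have "cinner (row_vector (a, b, c, d)) (tensor X Y) = 0"
        using w(3) nth_mem[OF i'] unfolding Ri XY by blast
      then show ?thesis
        using form_point_of[OF nz(1,2), of X] form_point_of[OF nz(3,4), of Y]
        unfolding cinner_row_tensor pts by auto
    qed
    ultimately show "\<exists>b\<in>B. \<exists>c. w = c *s b"
      unfolding XY by (rule B(3))
  qed
  show ?thesis
    unfolding complement_PPT_entangled_def n_def[symmetric] M_eq PPT_entangled_of_rank_def
      PPT_entangled_state_def PPT_def
    using dens pt ent rank by blast
qed

text \<open>A vector is removed from a set, so it must be known that no later row yields the same
  vector.\<close>

lemma row_vectors_but_first_eq:
  assumes "models I1 D1" "models I2 D2" "models I3 D3" "models I4 D4"
    and R: "realizes I1 I2 I3 I4 R t" and t: "sorted_wrt orthogonal_symbols t" and "R \<noteq> []"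
  shows "row_vectors_but_first R = row_vectors (tl R)"
proof -
  note rows = realizes_rows[OF assms(1-6)]
  have "orthonormal (set R) row_vector"
    using orthonormal_cnj_row[of "set R" "{}"] rows by simp
  then have "inj_on row_vector (set R)"
    unfolding orthonormal_def inj_on_def by (metis one_neq_zero)
  then show ?thesis
    using \<open>R \<noteq> []\<close> rows(1)
    by (cases R) (auto simp: row_vectors_but_first_def row_vectors_def)
qed

fun assignment :: "point list \<Rightarrow> symbol \<Rightarrow> point" where
  "assignment ps (Q n) = ps ! n"
| "assignment ps (Q' n) = antipode (ps ! n)"

lemma models_assignment:
  "models (assignment ps) E \<longleftrightarrow> (\<forall>(p, q)\<in>set E. assignment ps p \<noteq> assignment ps q)"
proof -
  have "assignment ps (dual p) = antipode (assignment ps p)" for p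
    by (cases p) simp_all
  then show ?thesis by (simp add: models_def)
qed

lemma certified_family:
  assumes "certificate (D1, D2, D3, D4) t"
    and "models I1 D1" "models I2 D2" "models I3 D3" "models I4 D4"
    and "realizes I1 I2 I3 I4 R t" "sorted_wrt orthogonal_symbols t" "length t = 8"
  shows "complement_PPT_entangled 8 (row_vectors R)"
  using certified_state[OF assms(1-7)] assms(8) by simp

lemma certified_family_but_first:
  assumes "certificate (D1, D2, D3, D4) (tl t)"
    and M: "models I1 D1" "models I2 D2" "models I3 D3" "models I4 D4"
    and R: "realizes I1 I2 I3 I4 R t" and t: "sorted_wrt orthogonal_symbols t" "length t = 8"
  shows "complement_PPT_entangled 9 (row_vectors_but_first R)"
proof -
  have "R \<noteq> []" "realizes I1 I2 I3 I4 (tl R) (tl t)" "sorted_wrt orthogonal_symbols (tl t)"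
    using R t by (cases t; cases R; simp add: realizes_def del: unit_row.simps orthogonal_symbols.simps)+
  then show ?thesis
    using certified_state[OF assms(1) M, of "tl R"] t(2) row_vectors_but_first_eq[OF M R t(1)]
    by simp
qed

section \<open>The six families\<close>

definition generic2 :: "(symbol \<times> symbol) list" where
  "generic2 = [(Q 0, Q 1), (Q 0, Q' 1)]"

text \<open>Permits \<open>Q 1\<close> and \<open>Q 2\<close> to be orthogonal, in contrast to
  \<open>generic3\<close>.\<close>

definition nearly_generic3 :: "(symbol \<times> symbol) list" where
  "nearly_generic3 = [(Q 0, Q 1), (Q 0, Q' 1), (Q 0, Q 2), (Q 0, Q' 2), (Q 1, Q 2)]"

definition generic3 :: "(symbol \<times> symbol) list" where
  "generic3 = (Q 1, Q' 2) # nearly_generic3"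

definition distinct_D2 :: "(symbol \<times> symbol) list" where
  "distinct_D2 = [(Q 0, Q 1), (Q 0, Q' 1), (Q 2, Q 3), (Q 2, Q' 3)]"

text \<open>The unconditional clauses of \<open>F6_cond\<close> on column D, with \<open>i2\<close>,
  \<open>i3\<close>, \<open>i4\<close> as \<open>Q 1\<close>, \<open>Q 2\<close>,
  \<open>Q 3\<close>.\<close>

definition distinct_D6 :: "(symbol \<times> symbol) list" where
  "distinct_D6 = [(Q 1, Q 0), (Q 1, Q' 2), (Q 1, Q 3), (Q 2, Q 0), (Q 2, Q 3), (Q 3, Q 0), (Q 3, Q' 0)]"

text \<open>Here and in the other unspecialised tables, \<open>Q 1\<close>, \<open>Q 2\<close> and
  so on are the parameters of a column in the order of their subscripts, and \<open>Q' 0\<close> is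
  \<open>k1\<close>.\<close>

definition table1 :: table where
  "table1 = [
    (Q 0, Q 0, Q 0, Q 0),
    (Q 0, Q' 0, Q 0, Q' 0),
    (Q' 0, Q 1, Q 1, Q 1),
    (Q' 0, Q' 1, Q 1, Q 2),
    (Q 1, Q' 1, Q' 0, Q' 2),
    (Q 1, Q 1, Q' 0, Q' 1),
    (Q' 1, Q 0, Q' 1, Q' 0),
    (Q' 1, Q' 0, Q' 1, Q 0)]"

definition table2 :: table where
  "table2 = [
    (Q 0, Q 0, Q 0, Q 0),
    (Q 0, Q' 0, Q 0, Q 1),
    (Q' 0, Q 1, Q 1, Q 2),
    (Q' 0, Q' 1, Q 1, Q 3),
    (Q 1, Q' 1, Q' 0, Q' 3),
    (Q 1, Q 1, Q' 0, Q' 2),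
    (Q' 1, Q' 0, Q' 1, Q' 1),
    (Q' 1, Q 0, Q' 1, Q' 0)]"

text \<open>The special tables arise by \<open>i\<^sub>3 = i\<^sub>2\<close> and \<open>i\<^sub>4 = 0\<close> (\<open>F\<^sub>2\<close>), by \<open>h\<^sub>4 = h\<^sub>3'\<close>
  (\<open>F\<^sub>3\<close>), by \<open>f\<^sub>6 = f\<^sub>5'\<close> (\<open>F\<^sub>5\<close>), and by \<open>i\<^sub>3 = i\<^sub>2\<close> (\<open>F\<^sub>6\<close>, where \<open>Q 2\<close> is then \<open>i\<^sub>4\<close>).\<close>

definition table2_special :: table where
  "table2_special = [
    (Q 0, Q 0, Q 0, Q 0),
    (Q 0, Q' 0, Q 0, Q 1),
    (Q' 0, Q 1, Q 1, Q 1),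
    (Q' 0, Q' 1, Q 1, Q 0),
    (Q 1, Q' 1, Q' 0, Q' 0),
    (Q 1, Q 1, Q' 0, Q' 1),
    (Q' 1, Q' 0, Q' 1, Q' 1),
    (Q' 1, Q 0, Q' 1, Q' 0)]"

definition table3 :: table where
  "table3 = [
    (Q 0, Q 0, Q 0, Q 0),
    (Q 0, Q' 0, Q 0, Q 1),
    (Q' 0, Q 1, Q 1, Q 0),
    (Q' 0, Q' 1, Q 2, Q 1),
    (Q 1, Q' 1, Q' 0, Q' 1),
    (Q 1, Q 1, Q' 0, Q' 0),
    (Q' 1, Q' 0, Q' 1, Q' 1),
    (Q' 1, Q 0, Q' 2, Q' 0)]"

definition table3_special :: table where
  "table3_special = [
    (Q 0, Q 0, Q 0, Q 0),
    (Q 0, Q' 0, Q 0, Q 1),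
    (Q' 0, Q 1, Q 1, Q 0),
    (Q' 0, Q' 1, Q' 1, Q 1),
    (Q 1, Q' 1, Q' 0, Q' 1),
    (Q 1, Q 1, Q' 0, Q' 0),
    (Q' 1, Q' 0, Q' 1, Q' 1),
    (Q' 1, Q 0, Q 1, Q' 0)]"

definition table4 :: table where
  "table4 = [
    (Q 0, Q 0, Q 0, Q 0),
    (Q 0, Q' 0, Q 0, Q 1),
    (Q' 0, Q 1, Q 1, Q 2),
    (Q' 0, Q 2, Q 1, Q' 2),
    (Q 1, Q' 1, Q' 0, Q 2),
    (Q 1, Q' 2, Q' 0, Q' 2),
    (Q' 1, Q' 0, Q' 1, Q' 1),
    (Q' 1, Q 0, Q' 1, Q' 0)]"

definition table5 :: table where
  "table5 = [
    (Q 0, Q 0, Q 0, Q 0),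
    (Q 0, Q' 0, Q 0, Q 1),
    (Q' 0, Q 1, Q 1, Q' 0),
    (Q' 0, Q' 1, Q 1, Q' 1),
    (Q 1, Q 1, Q' 0, Q 0),
    (Q 2, Q' 1, Q' 0, Q 1),
    (Q' 1, Q' 0, Q' 1, Q' 1),
    (Q' 2, Q 0, Q' 1, Q' 0)]"

definition table5_special :: table where
  "table5_special = [
    (Q 0, Q 0, Q 0, Q 0),
    (Q 0, Q' 0, Q 0, Q 1),
    (Q' 0, Q 1, Q 1, Q' 0),
    (Q' 0, Q' 1, Q 1, Q' 1),
    (Q 1, Q 1, Q' 0, Q 0),
    (Q' 1, Q' 1, Q' 0, Q 1),
    (Q' 1, Q' 0, Q' 1, Q' 1),
    (Q 1, Q 0, Q' 1, Q' 0)]"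

definition table6 :: table where
  "table6 = [
    (Q 0, Q 0, Q 0, Q 0),
    (Q 0, Q' 0, Q 1, Q 1),
    (Q' 0, Q 1, Q 0, Q 2),
    (Q' 0, Q' 1, Q 1, Q 3),
    (Q 1, Q' 0, Q' 1, Q' 2),
    (Q 1, Q 0, Q' 0, Q' 3),
    (Q' 1, Q 1, Q' 0, Q' 1),
    (Q' 1, Q' 1, Q' 1, Q' 0)]"

definition table6_special :: table where
  "table6_special = [
    (Q 0, Q 0, Q 0, Q 0),
    (Q 0, Q' 0, Q 1, Q 1),
    (Q' 0, Q 1, Q 0, Q 1),
    (Q' 0, Q' 1, Q 1, Q 2),
    (Q 1, Q' 0, Q' 1, Q' 1),
    (Q 1, Q 0, Q' 0, Q' 2),
    (Q' 1, Q 1, Q' 0, Q' 1),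
    (Q' 1, Q' 1, Q' 1, Q' 0)]"

text \<open>Exhaustive evaluation: eight rows leave at most seven candidates, seven rows at most
  eight.\<close>

lemma certificate1:
  "certificate (generic2, generic2, generic2, nearly_generic3) table1"
  "certificate (generic2, generic2, generic2, nearly_generic3) (tl table1)"
  by code_simp+

lemma certificate2:
  "certificate (generic2, generic2, generic2, distinct_D2) table2"
  "certificate (generic2, generic2, generic2, generic2) (tl table2_special)"
  by code_simp+

lemma certificate3:
  "certificate (generic2, generic2, nearly_generic3, generic2) table3"
  "certificate (generic2, generic2, generic3, generic2) (tl table3)"
  "certificate (generic2, generic2, generic2, generic2) (tl table3_special)"
  by code_simp+

lemma certificate4:
  "certificate (generic2, generic3, generic2, generic3) table4"
  "certificate (generic2, generic3, generic2, generic3) (tl table4)"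
  by code_simp+

lemma certificate5:
  "certificate (nearly_generic3, generic2, generic2, generic2) table5"
  "certificate (generic3, generic2, generic2, generic2) (tl table5)"
  "certificate (generic2, generic2, generic2, generic2) (tl table5_special)"
  by code_simp+

lemma certificate6:
  "certificate (generic2, generic2, generic2, distinct_D6) table6"
  "certificate (generic2, generic2, generic2, generic3) (tl table6_special)"
  by code_simp+

section \<open>Translation of the conditions on unit vectors into conditions on points\<close>

lemma norm_k0 [simp]: "norm k0 = 1" and norm_k1 [simp]: "norm k1 = 1"
  by (simp_all add: norm_vec_def L2_set_def sum_2 k0_def k1_def)

lemma norm_perp [simp]: "norm (perp u) = norm u"
  by (simp add: norm_vec_def L2_set_def sum_2 perp_def add.commute)

lemma point_of_perp_unit: "norm u = 1 \<Longrightarrow> point_of (perp u) = antipode (point_of u)"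
  by (rule point_of_perp) auto

lemma point_of_k1: "point_of k1 = antipode (point_of k0)"
  by (simp add: point_of_def antipode_def k0_def k1_def)

lemma same_ray_iff: "norm u = 1 \<Longrightarrow> norm s = 1 \<Longrightarrow> u \<doteq> s \<longleftrightarrow> point_of u = point_of s"
  using same_ray_if_point_of_eq point_of_eq_if_same_ray by blast

lemma models_generic2:
  assumes "p \<noteq> z" "p \<noteq> antipode z"
  shows "models (assignment [z, p]) generic2"
  using assms by (auto simp: models_assignment generic2_def)

lemma models_nearly_generic3:
  assumes "p \<noteq> z" "p \<noteq> antipode z" "q \<noteq> z" "q \<noteq> antipode z" "p \<noteq> q"
  shows "models (assignment [z, p, q]) nearly_generic3"
  using assms by (auto simp: models_assignment nearly_generic3_def)

lemma models_generic3:
  assumes "p \<noteq> z" "p \<noteq> antipode z" "q \<noteq> z" "q \<noteq> antipode z" "p \<noteq> q" "p \<noteq> antipode q"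
  shows "models (assignment [z, p, q]) generic3"
  using assms by (auto simp: models_assignment generic3_def nearly_generic3_def)

lemma models_distinct_D2:
  assumes "p \<noteq> z" "p \<noteq> antipode z" "q \<noteq> r" "q \<noteq> antipode r"
  shows "models (assignment [z, p, q, r]) distinct_D2"
  using assms by (auto simp: models_assignment distinct_D2_def)

lemma models_distinct_D6:
  assumes "p \<noteq> z" "p \<noteq> antipode q" "p \<noteq> r" "q \<noteq> z" "q \<noteq> r" "r \<noteq> z" "r \<noteq> antipode z"
  shows "models (assignment [z, p, q, r]) distinct_D6"
  using assms by (auto simp: models_assignment distinct_D6_def)

lemmas unit_points = avoids_def same_ray_iff point_of_perp_unit point_of_k1

section \<open>The states of rank eight and nine, family by family\<close>

lemma F1_eight:
  assumes "F1_cond f5 g3 h3 i3 i4"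
  shows "complement_PPT_entangled 8 (row_vectors (F1 f5 g3 h3 i3 i4))"
proof -
  have u: "norm f5 = 1" "norm g3 = 1" "norm h3 = 1" "norm i3 = 1" "norm i4 = 1"
    using assms by (auto simp: F1_cond_def)
  have models: "models (assignment [point_of k0, point_of f5]) generic2"
    "models (assignment [point_of k0, point_of g3]) generic2"
    "models (assignment [point_of k0, point_of h3]) generic2"
    "models (assignment [point_of k0, point_of i3, point_of i4]) nearly_generic3"
    using assms by (auto simp: F1_cond_def unit_points u intro!: models_generic2 models_nearly_generic3)
  have R: "realizes (assignment [point_of k0, point_of f5])
      (assignment [point_of k0, point_of g3])
      (assignment [point_of k0, point_of h3])
      (assignment [point_of k0, point_of i3, point_of i4])
      (F1 f5 g3 h3 i3 i4) table1"
    by (simp add: realizes_def F1_def table1_def u unit_points)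
  show ?thesis
    by (rule certified_family[OF certificate1(1) models R]) (simp_all add: table1_def)
qed

lemma F1_nine:
  assumes "F1_cond f5 g3 h3 i3 i4"
  shows "complement_PPT_entangled 9 (row_vectors_but_first (F1 f5 g3 h3 i3 i4))"
proof -
  have u: "norm f5 = 1" "norm g3 = 1" "norm h3 = 1" "norm i3 = 1" "norm i4 = 1"
    using assms by (auto simp: F1_cond_def)
  have models: "models (assignment [point_of k0, point_of f5]) generic2"
    "models (assignment [point_of k0, point_of g3]) generic2"
    "models (assignment [point_of k0, point_of h3]) generic2"
    "models (assignment [point_of k0, point_of i3, point_of i4]) nearly_generic3"
    using assms by (auto simp: F1_cond_def unit_points u intro!: models_generic2 models_nearly_generic3)
  have R: "realizes (assignment [point_of k0, point_of f5])
      (assignment [point_of k0, point_of g3])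
      (assignment [point_of k0, point_of h3])
      (assignment [point_of k0, point_of i3, point_of i4])
      (F1 f5 g3 h3 i3 i4) table1"
    by (simp add: realizes_def F1_def table1_def u unit_points)
  show ?thesis
    by (rule certified_family_but_first[OF certificate1(2) models R]) (simp_all add: table1_def)
qed

lemma F2_eight:
  assumes "F2_cond f5 g3 h3 i2 i3 i4"
  shows "complement_PPT_entangled 8 (row_vectors (F2 f5 g3 h3 i2 i3 i4))"
proof -
  have u: "norm f5 = 1" "norm g3 = 1" "norm h3 = 1" "norm i2 = 1" "norm i3 = 1" "norm i4 = 1"
    using assms by (auto simp: F2_cond_def)
  have models: "models (assignment [point_of k0, point_of f5]) generic2"
    "models (assignment [point_of k0, point_of g3]) generic2"
    "models (assignment [point_of k0, point_of h3]) generic2"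
    "models (assignment [point_of k0, point_of i2, point_of i3, point_of i4]) distinct_D2"
    using assms by (auto simp: F2_cond_def unit_points u intro!: models_distinct_D2 models_generic2)
  have R: "realizes (assignment [point_of k0, point_of f5])
      (assignment [point_of k0, point_of g3])
      (assignment [point_of k0, point_of h3])
      (assignment [point_of k0, point_of i2, point_of i3, point_of i4])
      (F2 f5 g3 h3 i2 i3 i4) table2"
    by (simp add: realizes_def F2_def table2_def u unit_points)
  show ?thesis
    by (rule certified_family[OF certificate2(1) models R]) (simp_all add: table2_def)
qed

lemma F2_nine:
  assumes "F2_cond f5 g3 h3 i2 i3 i4" "i2 \<doteq> i3" "i4 \<doteq> k0"
  shows "complement_PPT_entangled 9 (row_vectors_but_first (F2 f5 g3 h3 i2 i3 i4))"
proof -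
  have u: "norm f5 = 1" "norm g3 = 1" "norm h3 = 1" "norm i2 = 1" "norm i3 = 1" "norm i4 = 1"
    using assms by (auto simp: F2_cond_def)
  have special: "point_of i3 = point_of i2" "point_of i4 = point_of k0"
    using assms(2,3) by (auto dest: point_of_eq_if_same_ray)
  have models: "models (assignment [point_of k0, point_of f5]) generic2"
    "models (assignment [point_of k0, point_of g3]) generic2"
    "models (assignment [point_of k0, point_of h3]) generic2"
    "models (assignment [point_of k0, point_of i2]) generic2"
    using assms by (auto simp: F2_cond_def unit_points u intro!: models_generic2)
  have R: "realizes (assignment [point_of k0, point_of f5])
      (assignment [point_of k0, point_of g3])
      (assignment [point_of k0, point_of h3])
      (assignment [point_of k0, point_of i2])
      (F2 f5 g3 h3 i2 i3 i4) table2_special"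
    by (simp add: realizes_def F2_def table2_special_def u unit_points special)
  show ?thesis
    by (rule certified_family_but_first[OF certificate2(2) models R]) (simp_all add: table2_special_def)
qed

lemma F3_eight:
  assumes "F3_cond f5 g3 h3 h4 i2"
  shows "complement_PPT_entangled 8 (row_vectors (F3 f5 g3 h3 h4 i2))"
proof -
  have u: "norm f5 = 1" "norm g3 = 1" "norm h3 = 1" "norm h4 = 1" "norm i2 = 1"
    using assms by (auto simp: F3_cond_def)
  have models: "models (assignment [point_of k0, point_of f5]) generic2"
    "models (assignment [point_of k0, point_of g3]) generic2"
    "models (assignment [point_of k0, point_of h3, point_of h4]) nearly_generic3"
    "models (assignment [point_of k0, point_of i2]) generic2"
    using assms by (auto simp: F3_cond_def unit_points u intro!: models_generic2 models_nearly_generic3)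
  have R: "realizes (assignment [point_of k0, point_of f5])
      (assignment [point_of k0, point_of g3])
      (assignment [point_of k0, point_of h3, point_of h4])
      (assignment [point_of k0, point_of i2])
      (F3 f5 g3 h3 h4 i2) table3"
    by (simp add: realizes_def F3_def table3_def u unit_points)
  show ?thesis
    by (rule certified_family[OF certificate3(1) models R]) (simp_all add: table3_def)
qed

lemma F3_nine:
  assumes "F3_cond f5 g3 h3 h4 i2"
  shows "complement_PPT_entangled 9 (row_vectors_but_first (F3 f5 g3 h3 h4 i2))"
proof (cases "point_of h4 = antipode (point_of h3)")
  \<comment> \<open>If \<open>h4\<close> is orthogonal to \<open>h3\<close>, the symbol
    \<open>Q 2\<close> turns into \<open>Q' 1\<close>, which gives the special table. Otherwise
    column C satisfies \<open>generic3\<close>.\<close>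
  case True
  have u: "norm f5 = 1" "norm g3 = 1" "norm h3 = 1" "norm h4 = 1" "norm i2 = 1"
    using assms by (auto simp: F3_cond_def)
  have models: "models (assignment [point_of k0, point_of f5]) generic2"
    "models (assignment [point_of k0, point_of g3]) generic2"
    "models (assignment [point_of k0, point_of h3]) generic2"
    "models (assignment [point_of k0, point_of i2]) generic2"
    using assms by (auto simp: F3_cond_def unit_points u intro!: models_generic2)
  have R: "realizes (assignment [point_of k0, point_of f5])
      (assignment [point_of k0, point_of g3])
      (assignment [point_of k0, point_of h3])
      (assignment [point_of k0, point_of i2])
      (F3 f5 g3 h3 h4 i2) table3_special"
    by (simp add: realizes_def F3_def table3_special_def u unit_points True)
  show ?thesis
    by (rule certified_family_but_first[OF certificate3(3) models R]) (simp_all add: table3_special_def)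
next
  case False
  have u: "norm f5 = 1" "norm g3 = 1" "norm h3 = 1" "norm h4 = 1" "norm i2 = 1"
    using assms by (auto simp: F3_cond_def)
  have models: "models (assignment [point_of k0, point_of f5]) generic2"
    "models (assignment [point_of k0, point_of g3]) generic2"
    "models (assignment [point_of k0, point_of h3, point_of h4]) generic3"
    "models (assignment [point_of k0, point_of i2]) generic2"
    using assms False by (auto simp: F3_cond_def unit_points u intro!: models_generic2 models_generic3)
  have R: "realizes (assignment [point_of k0, point_of f5])
      (assignment [point_of k0, point_of g3])
      (assignment [point_of k0, point_of h3, point_of h4])
      (assignment [point_of k0, point_of i2])
      (F3 f5 g3 h3 h4 i2) table3"
    by (simp add: realizes_def F3_def table3_def u unit_points)
  show ?thesis
    by (rule certified_family_but_first[OF certificate3(2) models R]) (simp_all add: table3_def)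
qed

lemma F4_eight:
  assumes "F4_cond f5 g3 g4 h3 i2 i3"
  shows "complement_PPT_entangled 8 (row_vectors (F4 f5 g3 g4 h3 i2 i3))"
proof -
  have u: "norm f5 = 1" "norm g3 = 1" "norm g4 = 1" "norm h3 = 1" "norm i2 = 1" "norm i3 = 1"
    using assms by (auto simp: F4_cond_def)
  have models: "models (assignment [point_of k0, point_of f5]) generic2"
    "models (assignment [point_of k0, point_of g3, point_of g4]) generic3"
    "models (assignment [point_of k0, point_of h3]) generic2"
    "models (assignment [point_of k0, point_of i2, point_of i3]) generic3"
    using assms by (auto simp: F4_cond_def unit_points u intro!: models_generic2 models_generic3)
  have R: "realizes (assignment [point_of k0, point_of f5])
      (assignment [point_of k0, point_of g3, point_of g4])
      (assignment [point_of k0, point_of h3])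
      (assignment [point_of k0, point_of i2, point_of i3])
      (F4 f5 g3 g4 h3 i2 i3) table4"
    by (simp add: realizes_def F4_def table4_def u unit_points)
  show ?thesis
    by (rule certified_family[OF certificate4(1) models R]) (simp_all add: table4_def)
qed

lemma F4_nine:
  assumes "F4_cond f5 g3 g4 h3 i2 i3"
  shows "complement_PPT_entangled 9 (row_vectors_but_first (F4 f5 g3 g4 h3 i2 i3))"
proof -
  have u: "norm f5 = 1" "norm g3 = 1" "norm g4 = 1" "norm h3 = 1" "norm i2 = 1" "norm i3 = 1"
    using assms by (auto simp: F4_cond_def)
  have models: "models (assignment [point_of k0, point_of f5]) generic2"
    "models (assignment [point_of k0, point_of g3, point_of g4]) generic3"
    "models (assignment [point_of k0, point_of h3]) generic2"
    "models (assignment [point_of k0, point_of i2, point_of i3]) generic3"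
    using assms by (auto simp: F4_cond_def unit_points u intro!: models_generic2 models_generic3)
  have R: "realizes (assignment [point_of k0, point_of f5])
      (assignment [point_of k0, point_of g3, point_of g4])
      (assignment [point_of k0, point_of h3])
      (assignment [point_of k0, point_of i2, point_of i3])
      (F4 f5 g3 g4 h3 i2 i3) table4"
    by (simp add: realizes_def F4_def table4_def u unit_points)
  show ?thesis
    by (rule certified_family_but_first[OF certificate4(2) models R]) (simp_all add: table4_def)
qed

lemma F5_eight:
  assumes "F5_cond f5 f6 g3 h3 i2"
  shows "complement_PPT_entangled 8 (row_vectors (F5 f5 f6 g3 h3 i2))"
proof -
  have u: "norm f5 = 1" "norm f6 = 1" "norm g3 = 1" "norm h3 = 1" "norm i2 = 1"
    using assms by (auto simp: F5_cond_def)
  have models: "models (assignment [point_of k0, point_of f5, point_of f6]) nearly_generic3"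
    "models (assignment [point_of k0, point_of g3]) generic2"
    "models (assignment [point_of k0, point_of h3]) generic2"
    "models (assignment [point_of k0, point_of i2]) generic2"
    using assms by (auto simp: F5_cond_def unit_points u intro!: models_generic2 models_nearly_generic3)
  have R: "realizes (assignment [point_of k0, point_of f5, point_of f6])
      (assignment [point_of k0, point_of g3])
      (assignment [point_of k0, point_of h3])
      (assignment [point_of k0, point_of i2])
      (F5 f5 f6 g3 h3 i2) table5"
    by (simp add: realizes_def F5_def table5_def u unit_points)
  show ?thesis
    by (rule certified_family[OF certificate5(1) models R]) (simp_all add: table5_def)
qed

lemma F5_nine:
  assumes "F5_cond f5 f6 g3 h3 i2"
  shows "complement_PPT_entangled 9 (row_vectors_but_first (F5 f5 f6 g3 h3 i2))"
proof (cases "point_of f6 = antipode (point_of f5)")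
  \<comment> \<open>The same distinction for column A, between \<open>f6\<close> orthogonal to
    \<open>f5\<close> and \<open>generic3\<close>.\<close>
  case True
  have u: "norm f5 = 1" "norm f6 = 1" "norm g3 = 1" "norm h3 = 1" "norm i2 = 1"
    using assms by (auto simp: F5_cond_def)
  have models: "models (assignment [point_of k0, point_of f5]) generic2"
    "models (assignment [point_of k0, point_of g3]) generic2"
    "models (assignment [point_of k0, point_of h3]) generic2"
    "models (assignment [point_of k0, point_of i2]) generic2"
    using assms by (auto simp: F5_cond_def unit_points u intro!: models_generic2)
  have R: "realizes (assignment [point_of k0, point_of f5])
      (assignment [point_of k0, point_of g3])
      (assignment [point_of k0, point_of h3])
      (assignment [point_of k0, point_of i2])
      (F5 f5 f6 g3 h3 i2) table5_special"
    by (simp add: realizes_def F5_def table5_special_def u unit_points True)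
  show ?thesis
    by (rule certified_family_but_first[OF certificate5(3) models R]) (simp_all add: table5_special_def)
next
  case False
  have u: "norm f5 = 1" "norm f6 = 1" "norm g3 = 1" "norm h3 = 1" "norm i2 = 1"
    using assms by (auto simp: F5_cond_def)
  have models: "models (assignment [point_of k0, point_of f5, point_of f6]) generic3"
    "models (assignment [point_of k0, point_of g3]) generic2"
    "models (assignment [point_of k0, point_of h3]) generic2"
    "models (assignment [point_of k0, point_of i2]) generic2"
    using assms False by (auto simp: F5_cond_def unit_points u intro!: models_generic2 models_generic3)
  have R: "realizes (assignment [point_of k0, point_of f5, point_of f6])
      (assignment [point_of k0, point_of g3])
      (assignment [point_of k0, point_of h3])
      (assignment [point_of k0, point_of i2])
      (F5 f5 f6 g3 h3 i2) table5"
    by (simp add: realizes_def F5_def table5_def u unit_points)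
  show ?thesis
    by (rule certified_family_but_first[OF certificate5(2) models R]) (simp_all add: table5_def)
qed

lemma F6_eight:
  assumes "F6_cond f5 g3 h2 i2 i3 i4"
  shows "complement_PPT_entangled 8 (row_vectors (F6 f5 g3 h2 i2 i3 i4))"
proof -
  have u: "norm f5 = 1" "norm g3 = 1" "norm h2 = 1" "norm i2 = 1" "norm i3 = 1" "norm i4 = 1"
    using assms by (auto simp: F6_cond_def)
  have models: "models (assignment [point_of k0, point_of f5]) generic2"
    "models (assignment [point_of k0, point_of g3]) generic2"
    "models (assignment [point_of k0, point_of h2]) generic2"
    "models (assignment [point_of k0, point_of i2, point_of i3, point_of i4]) distinct_D6"
    using assms by (auto simp: F6_cond_def unit_points u intro!: models_distinct_D6 models_generic2)
  have R: "realizes (assignment [point_of k0, point_of f5])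
      (assignment [point_of k0, point_of g3])
      (assignment [point_of k0, point_of h2])
      (assignment [point_of k0, point_of i2, point_of i3, point_of i4])
      (F6 f5 g3 h2 i2 i3 i4) table6"
    by (simp add: realizes_def F6_def table6_def u unit_points)
  show ?thesis
    by (rule certified_family[OF certificate6(1) models R]) (simp_all add: table6_def)
qed

lemma F6_nine:
  assumes "F6_cond f5 g3 h2 i2 i3 i4" "i2 \<doteq> i3"
  shows "complement_PPT_entangled 9 (row_vectors_but_first (F6 f5 g3 h2 i2 i3 i4))"
proof -
  have u: "norm f5 = 1" "norm g3 = 1" "norm h2 = 1" "norm i2 = 1" "norm i3 = 1" "norm i4 = 1"
    using assms by (auto simp: F6_cond_def)
  have special: "point_of i3 = point_of i2"
    using assms(2) by (auto dest: point_of_eq_if_same_ray)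
  \<comment> \<open>Since \<open>i2\<close> and \<open>i3\<close> agree, the conditional clause of
    \<open>F6_cond\<close> fires and separates \<open>i2\<close> from \<open>k1\<close> and from the
    state orthogonal to \<open>i4\<close>; this yields \<open>generic3\<close> in column D.\<close>
  have models: "models (assignment [point_of k0, point_of f5]) generic2"
    "models (assignment [point_of k0, point_of g3]) generic2"
    "models (assignment [point_of k0, point_of h2]) generic2"
    "models (assignment [point_of k0, point_of i2, point_of i4]) generic3"
    using assms by (auto simp: F6_cond_def unit_points u intro!: models_generic2 models_generic3)
  have R: "realizes (assignment [point_of k0, point_of f5])
      (assignment [point_of k0, point_of g3])
      (assignment [point_of k0, point_of h2])
      (assignment [point_of k0, point_of i2, point_of i4])
      (F6 f5 g3 h2 i2 i3 i4) table6_special"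
    by (simp add: realizes_def F6_def table6_special_def u unit_points special)
  show ?thesis
    by (rule certified_family_but_first[OF certificate6(2) models R]) (simp_all add: table6_special_def)
qed

theorem theorem5:
  shows
    "(\<forall>M \<in> family1 \<union> family2 \<union> family3 \<union> family4 \<union> family5 \<union> family6.
        let \<alpha> = (1 / 8) *\<^sub>R (mat 1 - (\<Sum>\<psi>\<in>row_vectors M. proj \<psi>)) in
          PPT_entangled_state sys_4qubit \<alpha> \<and>
          PPT_entangled_state sys_2x2x4 \<alpha> \<and>
          PPT_entangled_state sys_4x4 \<alpha> \<and>
          rank \<alpha> = 8)
   \<and> (\<forall>M \<in> family1 \<union> family2_special \<union> family3 \<union> family4 \<union> family5 \<union> family6_special.
        let \<beta> = (1 / 9) *\<^sub>R (mat 1 - (\<Sum>\<psi>\<in>row_vectors_but_first M. proj \<psi>)) in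
          PPT_entangled_state sys_4qubit \<beta> \<and>
          PPT_entangled_state sys_2x2x4 \<beta> \<and>
          PPT_entangled_state sys_4x4 \<beta> \<and>
          rank \<beta> = 9)"
proof -
  have eight: "\<forall>M \<in> family1 \<union> family2 \<union> family3 \<union> family4 \<union> family5 \<union> family6.
      complement_PPT_entangled 8 (row_vectors M)"
    by (auto simp: family1_def family2_def family3_def family4_def family5_def family6_def
        intro: F1_eight F2_eight F3_eight F4_eight F5_eight F6_eight)
  have nine: "\<forall>M \<in> family1 \<union> family2_special \<union> family3 \<union> family4 \<union> family5 \<union> family6_special.
      complement_PPT_entangled 9 (row_vectors_but_first M)"
    by (auto simp: family1_def family2_special_def family3_def family4_def family5_def
        family6_special_def intro: F1_nine F2_nine F3_nine F4_nine F5_nine F6_nine)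
  show ?thesis
    using eight nine
    \<comment> \<open>\<open>of_nat_numeral\<close> turns the factors \<open>1 / real 8\<close> and
      \<open>1 / real 9\<close> into the literal ones.\<close>
    by (simp only: complement_PPT_entangled_def PPT_entangled_of_rank_def Let_def of_nat_numeral)
qed

end
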